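(* Given an LBDD instance with $n$ demand units and $k$ service centers, the ASRAL algorithm described below runs in $O(nk^3+nk^2\log n)$ time using $O(nk)$ space.
   Context: LBDD instance: a set $S=\{s_1,\dots,s_k\}$ of service centers, a set $D=\{d_1,\dots,d_n\}$ of demand units, a cost matrix $\mathcal{CM}$ giving a positive integer cost $\mathcal{CM}(d,s)$ for every $d\in D$, $s\in S$, a positive integer capacity $c_s$ for each $s$, and a penalty function $q_s$ for each $s$ giving a positive penalty (monotonically increasing in $j$, evaluable in constant time) for the $j$-th allotment beyond capacity. An allotment is a set of pairs $\langle d,s\rangle$, each $d$ in at most one pair. The allotment subspace multigraph $\Gamma(\mathcal{A})$ has vertex set $S$ and, for each $\langle d,s_p\rangle\in\mathcal{A}$ and each $s_q\neq s_p$, an edge $(s_p,s_q,d)$ of cost $\mathcal{CM}(d,s_q)-\mathcal{CM}(d,s_p)$. It is stored as one min-heap for each ordered pair $(s_p,s_q)$ of distinct centers, containing the demand units currently at $s_p$ keyed by transfer cost to $s_q$; adding/removing a unit at $s_p$ updates the $k-1$ heaps of $s_p$. ASRAL: (1) for each $d$ find the center $s_{min}(d)$ minimizing $\mathcal{CM}(d,\cdot)$ and build a min-heap of pairs $\langle d,s_{min}(d)\rangle$ keyed by $\mathcal{CM}(d,s_{min}(d))$; start with the empty allotment. (2) While the heap is nonempty: extract the minimum $\langle d_i,s_j\rangle$; allot $d_i$ to $s_j$ (updating the heaps); perform negative cycle refinement at $s_j$: build the $k$-vertex-plus-one graph in which $s_j$ is split into an out-copy and an in-copy and the edge from $u$ to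 $v$ has the minimum cost among edges from $u$ to $v$ in $\Gamma$ (read from heap tops), compute a lowest-cost path from the out-copy to the in-copy with the Bellman–Ford algorithm, and if its cost is negative perform the corresponding transfers (updating the heaps). If $s_j$ had free capacity, decrement it and add $\mathcal{CM}(d_i,s_j)$ to the objective. Otherwise add $\mathcal{CM}(d_i,s_j)+q_{s_j}$ to the objective and perform negative path refinement at $s_j$: build the analogous graph in which edges out of the out-copy and between other centers are minimum-cost $\Gamma$ edges and the edge from each center $u$ into the in-copy has cost (penalty at $u$) $-$ (penalty at $s_j$), compute a lowest-cost path from the out-copy to the in-copy with Bellman–Ford, and if negative perform the corresponding transfers (updating the heaps). *)

theory Defs
  imports Complex_Main "HOL-Library.State_Monad"
begin

section \<open>LBDD instances\<close>

text \<open>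
  Demand units are \<open>0, \<dots>, num_units I - 1\<close> and service centers are \<open>0, \<dots>, num_centers I - 1\<close>.
  \<open>penalty I s j\<close> is the penalty of the \<open>j\<close>-th allotment to \<open>s\<close> beyond its capacity, \<open>j \<ge> 1\<close>.
\<close>

record lbdd =
  num_units :: nat
  num_centers :: nat
  cost :: "nat \<Rightarrow> nat \<Rightarrow> nat"
  capacity :: "nat \<Rightarrow> nat"
  penalty :: "nat \<Rightarrow> nat \<Rightarrow> real"

definition lbdd_instance :: "lbdd \<Rightarrow> bool" where
  "lbdd_instance I \<longleftrightarrow>
     num_units I \<ge> 1 \<and> num_centers I \<ge> 1 \<and>
     (\<forall>d < num_units I. \<forall>s < num_centers I. cost I d s > 0) \<and>
     (\<forall>s < num_centers I. capacity I s > 0) \<and>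
     (\<forall>s < num_centers I. \<forall>j \<ge> 1. penalty I s j > 0) \<and>
     (\<forall>s < num_centers I. \<forall>i j. 1 \<le> i \<longrightarrow> i \<le> j \<longrightarrow> penalty I s i \<le> penalty I s j)"


section \<open>The machine\<close>

text \<open>
  ASRAL is a program for a unit-cost random access machine. A memory cell holds an index or a
  cost. Every memory access, penalty evaluation, loop iteration and recursive call is
  one step; the register operations between two steps are bounded in number. The space used is
  the largest number of cells that are occupied at the same time, the input (cost matrix and
  capacities) included; finitely many registers are not counted.

  There is one heap for each ordered pair of distinct centers, \<open>Transfer p q\<close>, and the heap
  \<open>Pending\<close> of the units not yet processed. The entries of a heap \<open>h\<close> of size \<open>m\<close> are the cells
  \<open>Key h i\<close> and \<open>Item h i\<close> with \<open>i < m\<close>, i.e. two arrays that grow and shrink at the end.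
  For each \<open>q\<close> a unit is in at most one heap \<open>Transfer p q\<close>, namely for its current center \<open>p\<close>, so
  that the positions of units in these heaps are one array \<open>TransferPos q d\<close>.
\<close>

datatype heap_id = Pending | Transfer nat nat

datatype cell =
    Cost nat nat      \<comment> \<open>input: cost of a unit at a center\<close>
  | Free nat          \<comment> \<open>remaining capacity of a center, initially the input capacity\<close>
  | Over nat          \<comment> \<open>number of units allotted to a center beyond its capacity\<close>
  | Load nat          \<comment> \<open>number of units at \<open>p\<close>, the common size of all heaps \<open>Transfer p q\<close>\<close>
  | Center nat        \<comment> \<open>the allotment: the center of a unit\<close>
  | Smin nat          \<comment> \<open>cheapest center of a unit\<close>
  | Objective
  | Key heap_id nat
  | Item heap_id nat
  | PendingPos nat
  | TransferPos nat nat
  | NumEdges          \<comment> \<open>the auxiliary graph is an array of edges\<close>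
  | EdgeSrc nat
  | EdgeDst nat
  | EdgeCost nat
  | EdgeUnit nat
  | Reached nat       \<comment> \<open>\<open>0\<close> iff the Bellman-Ford distance is infinite\<close>
  | Dist nat
  | PredEdge nat

datatype val = Idx (idx: nat) | Num (num: real)

record machine =
  memory :: "cell \<rightharpoonup> val"
  steps :: nat
  peak :: nat

type_synonym 'a prog = "(machine, 'a) state"

definition tick :: "unit prog" where
  "tick = State (\<lambda>s. ((), s\<lparr>steps := steps s + 1\<rparr>))"

text \<open>The program only reads occupied cells.\<close>

definition rd :: "cell \<Rightarrow> val prog" where
  "rd c = State (\<lambda>s. (the (memory s c), s\<lparr>steps := steps s + 1\<rparr>))"

definition rd_idx :: "cell \<Rightarrow> nat prog" where
  "rd_idx c = do { v \<leftarrow> rd c; State_Monad.return (idx v) }"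

definition rd_num :: "cell \<Rightarrow> real prog" where
  "rd_num c = do { v \<leftarrow> rd c; State_Monad.return (num v) }"

definition wr :: "cell \<Rightarrow> val \<Rightarrow> unit prog" where
  "wr c v = State (\<lambda>s. let M = (memory s)(c \<mapsto> v) in
     ((), s\<lparr>memory := M, steps := steps s + 1, peak := max (peak s) (card (dom M))\<rparr>))"

definition release :: "cell \<Rightarrow> unit prog" where
  "release c = State (\<lambda>s. ((), s\<lparr>memory := (memory s)(c := None), steps := steps s + 1\<rparr>))"

definition eval_penalty :: "lbdd \<Rightarrow> nat \<Rightarrow> nat \<Rightarrow> real prog" where
  "eval_penalty I s j = do { tick; State_Monad.return (penalty I s j) }"

primrec for_each :: "nat list \<Rightarrow> (nat \<Rightarrow> unit prog) \<Rightarrow> unit prog" where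
  "for_each [] f = State_Monad.return ()"
| "for_each (x # xs) f = do { tick; f x; for_each xs f }"


section \<open>Binary min-heaps with positions\<close>

fun pos_cell :: "heap_id \<Rightarrow> nat \<Rightarrow> cell" where
  "pos_cell Pending d = PendingPos d"
| "pos_cell (Transfer p q) d = TransferPos q d"

definition heap_swap :: "heap_id \<Rightarrow> nat \<Rightarrow> nat \<Rightarrow> unit prog" where
  "heap_swap h i j = do {
     ki \<leftarrow> rd_num (Key h i); kj \<leftarrow> rd_num (Key h j);
     di \<leftarrow> rd_idx (Item h i); dj \<leftarrow> rd_idx (Item h j);
     wr (Key h i) (Num kj); wr (Key h j) (Num ki);
     wr (Item h i) (Idx dj); wr (Item h j) (Idx di);
     wr (pos_cell h dj) (Idx i); wr (pos_cell h di) (Idx j) }"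

fun sift_up :: "heap_id \<Rightarrow> nat \<Rightarrow> unit prog" where
  "sift_up h i = do {
     tick;
     if i = 0 then State_Monad.return ()
     else do {
       ki \<leftarrow> rd_num (Key h i); kp \<leftarrow> rd_num (Key h ((i - 1) div 2));
       if ki < kp then do { heap_swap h i ((i - 1) div 2); sift_up h ((i - 1) div 2) }
       else State_Monad.return () } }"

definition right_smaller :: "heap_id \<Rightarrow> nat \<Rightarrow> nat \<Rightarrow> bool prog" where
  "right_smaller h m i =
     (if 2 * i + 2 < m then do {
        kl \<leftarrow> rd_num (Key h (2 * i + 1)); kr \<leftarrow> rd_num (Key h (2 * i + 2));
        State_Monad.return (kr < kl) }
      else State_Monad.return False)"

function sift_down :: "heap_id \<Rightarrow> nat \<Rightarrow> nat \<Rightarrow> unit prog" where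
  "sift_down h m i = do {
     tick;
     if 2 * i + 1 \<ge> m then State_Monad.return ()
     else do {
       r \<leftarrow> right_smaller h m i;
       let c = (if r then 2 * i + 2 else 2 * i + 1);
       ki \<leftarrow> rd_num (Key h i); kc \<leftarrow> rd_num (Key h c);
       if kc < ki then do { heap_swap h i c; sift_down h m c }
       else State_Monad.return () } }"
  by pat_completeness auto
termination
  by (relation "measure (\<lambda>(h, m, i). m - i)") auto

declare sift_up.simps [simp del] sift_down.simps [simp del]

text \<open>In the next two operations \<open>m\<close> is the size of \<open>h\<close> before the operation.\<close>

definition heap_insert :: "heap_id \<Rightarrow> nat \<Rightarrow> nat \<Rightarrow> real \<Rightarrow> unit prog" where
  "heap_insert h m d key = do {
     wr (Key h m) (Num key); wr (Item h m) (Idx d); wr (pos_cell h d) (Idx m);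
     sift_up h m }"

definition heap_delete :: "heap_id \<Rightarrow> nat \<Rightarrow> nat \<Rightarrow> unit prog" where
  "heap_delete h m d = do {
     i \<leftarrow> rd_idx (pos_cell h d);
     heap_swap h i (m - 1);
     release (Key h (m - 1)); release (Item h (m - 1)); release (pos_cell h d);
     if i < m - 1 then do { sift_up h i; sift_down h (m - 1) i }
     else State_Monad.return () }"


section \<open>The allotment subspace multigraph\<close>

definition add_unit :: "lbdd \<Rightarrow> nat \<Rightarrow> nat \<Rightarrow> unit prog" where
  "add_unit I d p = do {
     m \<leftarrow> rd_idx (Load p);
     cp \<leftarrow> rd_num (Cost d p);
     for_each [0..<num_centers I] (\<lambda>q.
       if q = p then State_Monad.return ()
       else do { cq \<leftarrow> rd_num (Cost d q); heap_insert (Transfer p q) m d (cq - cp) });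
     wr (Load p) (Idx (m + 1));
     wr (Center d) (Idx p) }"

definition remove_unit :: "lbdd \<Rightarrow> nat \<Rightarrow> nat \<Rightarrow> unit prog" where
  "remove_unit I d p = do {
     m \<leftarrow> rd_idx (Load p);
     for_each [0..<num_centers I] (\<lambda>q.
       if q = p then State_Monad.return () else heap_delete (Transfer p q) m d);
     wr (Load p) (Idx (m - 1)) }"

definition transfer_unit :: "lbdd \<Rightarrow> nat \<Rightarrow> nat \<Rightarrow> unit prog" where
  "transfer_unit I d q = do { p \<leftarrow> rd_idx (Center d); remove_unit I d p; add_unit I d q }"


section \<open>The auxiliary graphs\<close>

text \<open>
  In the graphs for \<open>s\<^sub>j\<close> the out-copy is vertex \<open>j\<close>, the in-copy is vertex \<open>num_centers I\<close>, and every
  other center is its own vertex.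
\<close>

definition add_edge :: "nat \<Rightarrow> nat \<Rightarrow> real \<Rightarrow> nat \<Rightarrow> unit prog" where
  "add_edge u v w d = do {
     e \<leftarrow> rd_idx NumEdges;
     wr (EdgeSrc e) (Idx u); wr (EdgeDst e) (Idx v); wr (EdgeCost e) (Num w); wr (EdgeUnit e) (Idx d);
     wr NumEdges (Idx (e + 1)) }"

text \<open>
  \<open>add_top_edges I u f\<close> adds the cheapest edge from \<open>u\<close> to each \<open>v \<noteq> u\<close> with \<open>f v = Some v'\<close>,
  redirected to \<open>v'\<close>.
\<close>

definition add_top_edges :: "lbdd \<Rightarrow> nat \<Rightarrow> (nat \<Rightarrow> nat option) \<Rightarrow> unit prog" where
  "add_top_edges I u f = do {
     m \<leftarrow> rd_idx (Load u);
     if m = 0 then State_Monad.return ()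
     else for_each [0..<num_centers I] (\<lambda>v.
       if v = u then State_Monad.return ()
       else (case f v of
           None \<Rightarrow> State_Monad.return ()
         | Some v' \<Rightarrow> do {
             w \<leftarrow> rd_num (Key (Transfer u v) 0); d \<leftarrow> rd_idx (Item (Transfer u v) 0);
             add_edge u v' w d })) }"

definition build_cycle_graph :: "lbdd \<Rightarrow> nat \<Rightarrow> unit prog" where
  "build_cycle_graph I j = do {
     wr NumEdges (Idx 0);
     for_each [0..<num_centers I] (\<lambda>u.
       add_top_edges I u (\<lambda>v. Some (if v = j then num_centers I else v))) }"

text \<open>
  The penalty at \<open>s\<^sub>j\<close> is that of its last allotment, which releasing a unit would save; the penalty
  at any other center is that of its next allotment, which is \<open>0\<close> if it has free capacity.
  No transfer is attached to the edges into the in-copy; their unit \<open>0\<close> is a dummy.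
\<close>

definition next_penalty :: "lbdd \<Rightarrow> nat \<Rightarrow> real prog" where
  "next_penalty I u = do {
     c \<leftarrow> rd_idx (Free u);
     if c > 0 then State_Monad.return 0
     else do { ov \<leftarrow> rd_idx (Over u); eval_penalty I u (ov + 1) } }"

definition build_path_graph :: "lbdd \<Rightarrow> nat \<Rightarrow> unit prog" where
  "build_path_graph I j = do {
     wr NumEdges (Idx 0);
     ov \<leftarrow> rd_idx (Over j);
     pj \<leftarrow> eval_penalty I j ov;
     for_each [0..<num_centers I] (\<lambda>u. do {
       add_top_edges I u (\<lambda>v. if v = j then None else Some v);
       if u = j then State_Monad.return ()
       else do { pu \<leftarrow> next_penalty I u; add_edge u (num_centers I) (pu - pj) 0 } }) }"


section \<open>Bellman-Ford\<close>

definition relax :: "nat \<Rightarrow> unit prog" where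
  "relax e = do {
     u \<leftarrow> rd_idx (EdgeSrc e); v \<leftarrow> rd_idx (EdgeDst e); w \<leftarrow> rd_num (EdgeCost e);
     ru \<leftarrow> rd_idx (Reached u);
     if ru = 0 then State_Monad.return ()
     else do {
       du \<leftarrow> rd_num (Dist u); rv \<leftarrow> rd_idx (Reached v); dv \<leftarrow> rd_num (Dist v);
       if rv = 0 \<or> du + w < dv then do {
         wr (Reached v) (Idx 1); wr (Dist v) (Num (du + w)); wr (PredEdge v) (Idx e) }
       else State_Monad.return () } }"

text \<open>The graph has \<open>num_centers I + 1\<close> vertices, hence \<open>num_centers I\<close> rounds.\<close>

definition bellman_ford :: "lbdd \<Rightarrow> nat \<Rightarrow> unit prog" where
  "bellman_ford I j = do {
     for_each [0..<num_centers I + 1] (\<lambda>v. do { wr (Reached v) (Idx 0); wr (Dist v) (Num 0) });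
     wr (Reached j) (Idx 1);
     m \<leftarrow> rd_idx NumEdges;
     for_each [0..<num_centers I] (\<lambda>_. for_each [0..<m] relax) }"


section \<open>ASRAL\<close>

text \<open>
  \<open>follow_path I j enter r v\<close> follows the predecessor edges from \<open>v\<close> back to the out-copy \<open>j\<close> and
  performs their transfers; \<open>enter\<close> is what is done for the edge into the in-copy. A simple path
  has at most \<open>num_centers I\<close> edges, so the loop is started with \<open>r = num_centers I\<close>.
\<close>

primrec follow_path :: "lbdd \<Rightarrow> nat \<Rightarrow> (nat \<Rightarrow> unit prog) \<Rightarrow> nat \<Rightarrow> nat \<Rightarrow> unit prog" where
  "follow_path I j enter 0 v = State_Monad.return ()"
| "follow_path I j enter (Suc r) v =
     (if v = j then State_Monad.return ()
      else do {
        tick;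
        e \<leftarrow> rd_idx (PredEdge v);
        u \<leftarrow> rd_idx (EdgeSrc e);
        (if v = num_centers I then enter e
         else do { d \<leftarrow> rd_idx (EdgeUnit e); transfer_unit I d v });
        follow_path I j enter r u })"

definition add_to_objective :: "real \<Rightarrow> unit prog" where
  "add_to_objective x = do { y \<leftarrow> rd_num Objective; wr Objective (Num (y + x)) }"

definition refine :: "lbdd \<Rightarrow> nat \<Rightarrow> (nat \<Rightarrow> unit prog) \<Rightarrow> unit prog" where
  "refine I j enter = do {
     bellman_ford I j;
     r \<leftarrow> rd_idx (Reached (num_centers I));
     x \<leftarrow> rd_num (Dist (num_centers I));
     if r \<noteq> 0 \<and> x < 0 then do {
       follow_path I j enter (num_centers I) (num_centers I);
       add_to_objective x }
     else State_Monad.return () }"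

definition negative_cycle_refinement :: "lbdd \<Rightarrow> nat \<Rightarrow> unit prog" where
  "negative_cycle_refinement I j = do {
     build_cycle_graph I j;
     refine I j (\<lambda>e. do { d \<leftarrow> rd_idx (EdgeUnit e); transfer_unit I d j }) }"

definition take_slot :: "nat \<Rightarrow> unit prog" where
  "take_slot u = do {
     c \<leftarrow> rd_idx (Free u);
     if c > 0 then wr (Free u) (Idx (c - 1))
     else do { ov \<leftarrow> rd_idx (Over u); wr (Over u) (Idx (ov + 1)) } }"

definition negative_path_refinement :: "lbdd \<Rightarrow> nat \<Rightarrow> unit prog" where
  "negative_path_refinement I j = do {
     build_path_graph I j;
     refine I j (\<lambda>e. do {
       u \<leftarrow> rd_idx (EdgeSrc e);
       take_slot u;
       ov \<leftarrow> rd_idx (Over j);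
       wr (Over j) (Idx (ov - 1)) }) }"

definition process_unit :: "lbdd \<Rightarrow> nat \<Rightarrow> nat \<Rightarrow> unit prog" where
  "process_unit I d j = do {
     add_unit I d j;
     negative_cycle_refinement I j;
     x \<leftarrow> rd_num (Cost d j);
     c \<leftarrow> rd_idx (Free j);
     take_slot j;
     if c > 0 then add_to_objective x
     else do {
       ov \<leftarrow> rd_idx (Over j);
       p \<leftarrow> eval_penalty I j ov;
       add_to_objective (x + p);
       negative_path_refinement I j } }"

definition find_smin :: "lbdd \<Rightarrow> nat \<Rightarrow> unit prog" where
  "find_smin I d = do {
     wr (Smin d) (Idx 0);
     for_each [1..<num_centers I] (\<lambda>s. do {
       x \<leftarrow> rd_num (Cost d s);
       b \<leftarrow> rd_idx (Smin d);
       y \<leftarrow> rd_num (Cost d b);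
       if x < y then wr (Smin d) (Idx s) else State_Monad.return () }) }"

definition asral_init :: "lbdd \<Rightarrow> unit prog" where
  "asral_init I = do {
     wr Objective (Num 0);
     for_each [0..<num_centers I] (\<lambda>s. do { wr (Load s) (Idx 0); wr (Over s) (Idx 0) });
     for_each [0..<num_units I] (\<lambda>d. do {
       find_smin I d;
       b \<leftarrow> rd_idx (Smin d);
       x \<leftarrow> rd_num (Cost d b);
       heap_insert Pending d d x }) }"

text \<open>The numeric argument is the size of the heap \<open>Pending\<close>.\<close>

primrec asral_loop :: "lbdd \<Rightarrow> nat \<Rightarrow> unit prog" where
  "asral_loop I 0 = State_Monad.return ()"
| "asral_loop I (Suc m) = do {
     tick;
     d \<leftarrow> rd_idx (Item Pending 0);
     heap_delete Pending (Suc m) d;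
     j \<leftarrow> rd_idx (Smin d);
     process_unit I d j;
     asral_loop I m }"

definition asral :: "lbdd \<Rightarrow> unit prog" where
  "asral I = do { asral_init I; asral_loop I (num_units I) }"

fun input_memory :: "lbdd \<Rightarrow> cell \<Rightarrow> val option" where
  "input_memory I (Cost d s) =
     (if d < num_units I \<and> s < num_centers I then Some (Num (real (cost I d s))) else None)"
| "input_memory I (Free s) = (if s < num_centers I then Some (Idx (capacity I s)) else None)"
| "input_memory I _ = None"

definition asral_run :: "lbdd \<Rightarrow> machine" where
  "asral_run I = snd (run_state (asral I)
     \<lparr>memory = input_memory I, steps = 0, peak = card (dom (input_memory I))\<rparr>)"

definition asral_time :: "lbdd \<Rightarrow> nat" where
  "asral_time I = steps (asral_run I)"

definition asral_space :: "lbdd \<Rightarrow> nat" where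
  "asral_space I = peak (asral_run I)"

end

theory Submission
  imports Defs
begin

text \<open>
  The running time and the space are bounded by one invariant, which holds at every update of the
  allotment: each transfer heap \<open>Transfer p q\<close> contains exactly the units whose center is \<open>p\<close>, and its
  position array is inverse to its item array. Hence all heaps have at most \<open>n\<close> entries, a heap operation
  costs \<open>O(log n)\<close>, a transfer \<open>O(k log n)\<close>, and a path of at most \<open>k\<close> edges \<open>O(k\<^sup>2 log n)\<close>; the
  auxiliary graphs have \<open>O(k\<^sup>2)\<close> edges, so that Bellman-Ford takes \<open>O(k\<^sup>3)\<close> steps per unit.
  For the space, the heaps leaving \<open>p\<close> occupy \<open>O(k)\<close> cells for each unit at \<open>p\<close>, which sums up to
  \<open>O(n k)\<close>, and edges leave only nonempty centers, of which there are at most \<open>n\<close>.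
  That Bellman-Ford finds lowest-cost paths, or paths at all, is irrelevant to both bounds.
\<close>

section \<open>Resource-aware weakest preconditions\<close>

text \<open>The obstacle is the space bound. The key and item slots of the heaps leaving
  \<open>p\<close> are as many as the load of \<open>p\<close>, so over all allotments together they
  number about n k^2. The occupied cells therefore have to be confined to a family of sets, each
  small because the loads of one allotment sum to at most n. A power set \<open>Pow V\<close> is
  convenient for straight-line code; the family for the whole run is the union of such power sets,
  one for each allotment, and a change of loads is a passage from one to another. Hence the
  shrinking of a heap must be visible in the invariant, which records that slots past its end are
  unoccupied. Refinement moves units while edges recorded earlier are still to be followed. A
  transfer changes the allotment but not the set of allotted units, so this set is what ties the
  recorded edges to the state. An exponent \<open>b\<close> with n <= 2^b stands for log n up to the
  final theorem.\<close>

text \<open>\<open>Q\<close> also sees the total number of steps. The set of occupied cells has to lie in the family \<open>D\<close>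
  at every moment of the run, so that the peak is bounded by the largest member of \<open>D\<close>.\<close>

definition exec ::
  "cell set set \<Rightarrow> 'a prog \<Rightarrow> ('a \<Rightarrow> (cell \<rightharpoonup> val) \<Rightarrow> nat \<Rightarrow> bool) \<Rightarrow> (cell \<rightharpoonup> val) \<Rightarrow> nat \<Rightarrow> bool" where
  "exec D c Q M t \<longleftrightarrow> (dom M \<in> D \<longrightarrow>
     (\<forall>s. memory s = M \<longrightarrow> steps s = t \<longrightarrow>
       (case run_state c s of (r, s') \<Rightarrow>
          Q r (memory s') (steps s') \<and> dom (memory s') \<in> D \<and>
          (\<forall>S. (\<forall>X\<in>D. card X \<le> S) \<longrightarrow> peak s' \<le> max (peak s) S))))"

abbreviation ix :: "(cell \<rightharpoonup> val) \<Rightarrow> cell \<Rightarrow> nat" where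
  "ix M c \<equiv> idx (the (M c))"

lemma exec_bind:
  assumes "exec D c R M t"
    and "\<And>r M' t'. R r M' t' \<Longrightarrow> dom M' \<in> D \<Longrightarrow> exec D (f r) Q M' t'"
  shows "exec D (State_Monad.bind c f) Q M t"
  unfolding exec_def
proof (intro impI allI)
  fix s :: machine
  assume M: "dom M \<in> D" "memory s = M" "steps s = t"
  obtain r s' where r: "run_state c s = (r, s')" by fastforce
  have 1: "R r (memory s') (steps s')" "dom (memory s') \<in> D"
    "\<And>S. (\<forall>X\<in>D. card X \<le> S) \<Longrightarrow> peak s' \<le> max (peak s) S"
    using assms(1) M r unfolding exec_def by auto
  obtain r' s'' where r': "run_state (f r) s' = (r', s'')" by fastforce
  have 2: "Q r' (memory s'') (steps s'')" "dom (memory s'') \<in> D"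
    "\<And>S. (\<forall>X\<in>D. card X \<le> S) \<Longrightarrow> peak s'' \<le> max (peak s') S"
    using assms(2)[OF 1(1,2)] 1(2) r' unfolding exec_def by auto
  show "case run_state (State_Monad.bind c f) s of (r, s') \<Rightarrow>
          Q r (memory s') (steps s') \<and> dom (memory s') \<in> D \<and>
          (\<forall>S. (\<forall>X\<in>D. card X \<le> S) \<longrightarrow> peak s' \<le> max (peak s) S)"
    using r r' 2 1(3) by (simp; smt (verit) max.bounded_iff max_def)
qed

lemma exec_conseq:
  assumes "exec D c Q M t" and "\<And>r M' t'. Q r M' t' \<Longrightarrow> dom M' \<in> D \<Longrightarrow> Q' r M' t'"
  shows "exec D c Q' M t"
  unfolding exec_def
proof (intro impI allI)
  fix s :: machine
  assume M: "dom M \<in> D" "memory s = M" "steps s = t"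
  obtain r s' where r: "run_state c s = (r, s')" by fastforce
  show "case run_state c s of (r, s') \<Rightarrow>
          Q' r (memory s') (steps s') \<and> dom (memory s') \<in> D \<and>
          (\<forall>S. (\<forall>X\<in>D. card X \<le> S) \<longrightarrow> peak s' \<le> max (peak s) S)"
    using assms(1) assms(2)[of r "memory s'" "steps s'"] M r unfolding exec_def by auto
qed

lemma exec_dom: "(dom M \<in> D \<Longrightarrow> exec D c Q M t) \<Longrightarrow> exec D c Q M t"
  by (cases "dom M \<in> D") (simp_all add: exec_def)

text \<open>The run never leaves the smaller family, and a bound on all members of \<open>D'\<close>
  also bounds those of \<open>D\<close>. The conclusion keeps \<open>dom M' \<in> D\<close>, which
  the enlarged family alone would forget.\<close>

lemma exec_mono:
  assumes "exec D c Q M t" "D \<subseteq> D'" "dom M \<in> D' \<Longrightarrow> dom M \<in> D"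
  shows "exec D' c (\<lambda>r M' t'. Q r M' t' \<and> dom M' \<in> D) M t"
  unfolding exec_def
proof (intro impI allI)
  fix s :: machine
  assume M: "dom M \<in> D'" "memory s = M" "steps s = t"
  obtain r s' where r: "run_state c s = (r, s')" by fastforce
  show "case run_state c s of (r, s') \<Rightarrow>
          (Q r (memory s') (steps s') \<and> dom (memory s') \<in> D) \<and> dom (memory s') \<in> D' \<and>
          (\<forall>S. (\<forall>X\<in>D'. card X \<le> S) \<longrightarrow> peak s' \<le> max (peak s) S)"
  proof -
    have "Q r (memory s') (steps s') \<and> dom (memory s') \<in> D \<and>
        (\<forall>S. (\<forall>X\<in>D. card X \<le> S) \<longrightarrow> peak s' \<le> max (peak s) S)"
      using assms(1) assms(3)[OF M(1)] M r unfolding exec_def by auto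
    then show ?thesis using assms(2) r by auto
  qed
qed

section \<open>Rules for primitive commands and loops\<close>

lemma exec_return: "Q x M t \<Longrightarrow> exec D (State_Monad.return x) Q M t"
  unfolding exec_def by auto

lemma exec_tick: "Q () M (t + 1) \<Longrightarrow> exec D tick Q M t"
  unfolding exec_def tick_def by auto

text \<open>\<open>Pow V\<close> is closed under occupying a cell of \<open>V\<close> and under
  releasing any cell, so the side condition is local to the cell written.\<close>

lemma exec_wr:
  assumes "c \<in> V" "Q () (M(c \<mapsto> v)) (t + 1)"
  shows "exec (Pow V) (wr c v) Q M t"
  using assms unfolding exec_def wr_def Let_def
  by (auto simp: max.coboundedI2)

lemma exec_release:
  assumes "Q () (M(c := None)) (t + 1)"
  shows "exec (Pow V) (release c) Q M t"
  using assms unfolding exec_def release_def by auto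

lemma exec_rd_idx: "Q (ix M c) M (t + 1) \<Longrightarrow> exec D (rd_idx c) Q M t"
  unfolding rd_idx_def exec_def rd_def by auto

lemma exec_rd_num: "Q (num (the (M c))) M (t + 1) \<Longrightarrow> exec D (rd_num c) Q M t"
  unfolding rd_num_def exec_def rd_def by auto

lemma exec_eval_penalty: "Q (penalty I s j) M (t + 1) \<Longrightarrow> exec D (eval_penalty I s j) Q M t"
  unfolding eval_penalty_def exec_def tick_def by auto

lemma exec_if:
  "(b \<Longrightarrow> exec D x Q M t) \<Longrightarrow> (\<not> b \<Longrightarrow> exec D y Q M t) \<Longrightarrow> exec D (if b then x else y) Q M t"
  by simp

lemma exec_bind_if:
  "(b \<Longrightarrow> exec D (State_Monad.bind x f) Q M t) \<Longrightarrow> (\<not> b \<Longrightarrow> exec D (State_Monad.bind y f) Q M t) \<Longrightarrow>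
   exec D (State_Monad.bind (if b then x else y) f) Q M t"
  by simp

lemma exec_bind_assoc:
  "exec D (State_Monad.bind c (\<lambda>x. State_Monad.bind (f x) g)) Q M t \<Longrightarrow>
   exec D (State_Monad.bind (State_Monad.bind c f) g) Q M t"
  by simp

lemma exec_bind_return: "exec D (f x) Q M t \<Longrightarrow> exec D (State_Monad.bind (State_Monad.return x) f) Q M t"
  by simp

lemma exec_bind_tick: "exec D (f ()) Q M (t + 1) \<Longrightarrow> exec D (State_Monad.bind tick f) Q M t"
  by (rule exec_bind[OF exec_tick[where Q = "\<lambda>_ M' t'. M' = M \<and> t' = t + 1"]]) auto

lemma exec_bind_rd_idx: "exec D (f (ix M c)) Q M (t + 1) \<Longrightarrow> exec D (State_Monad.bind (rd_idx c) f) Q M t"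
  by (rule exec_bind[OF exec_rd_idx[where Q = "\<lambda>r M' t'. r = ix M c \<and> M' = M \<and> t' = t + 1"]]) auto

lemma exec_bind_rd_num:
  "exec D (f (num (the (M c)))) Q M (t + 1) \<Longrightarrow> exec D (State_Monad.bind (rd_num c) f) Q M t"
  by (rule exec_bind[OF exec_rd_num[where Q = "\<lambda>r M' t'. r = num (the (M c)) \<and> M' = M \<and> t' = t + 1"]])
    auto

lemma exec_bind_eval_penalty:
  "exec D (f (penalty I s j)) Q M (t + 1) \<Longrightarrow> exec D (State_Monad.bind (eval_penalty I s j) f) Q M t"
  by (rule exec_bind[OF exec_eval_penalty[where Q = "\<lambda>r M' t'. r = penalty I s j \<and> M' = M \<and> t' = t + 1"]])
    auto

lemma exec_bind_wr:
  assumes "c \<in> V" "exec (Pow V) (f ()) Q (M(c \<mapsto> v)) (t + 1)"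
  shows "exec (Pow V) (State_Monad.bind (wr c v) f) Q M t"
  using assms
  by (intro exec_bind[OF exec_wr[where Q = "\<lambda>_ M' t'. M' = M(c \<mapsto> v) \<and> t' = t + 1"]]) auto

lemma exec_bind_release:
  assumes "exec (Pow V) (f ()) Q (M(c := None)) (t + 1)"
  shows "exec (Pow V) (State_Monad.bind (release c) f) Q M t"
  using assms
  by (intro exec_bind[OF exec_release[where Q = "\<lambda>_ M' t'. M' = M(c := None) \<and> t' = t + 1"]]) auto

text \<open>One rule for each primitive in last position and one for it at the head of a bind, with
  exact memory and step count; \<open>exec_bind_assoc\<close> and \<open>exec_bind_if\<close>
  flatten nested programs. Thus \<open>intro exec_rules\<close> is a symbolic execution of loop-free
  code.\<close>

lemmas exec_rules =
  exec_return exec_tick exec_rd_idx exec_rd_num exec_eval_penalty exec_wr exec_release exec_if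
  exec_bind_return exec_bind_tick exec_bind_rd_idx exec_bind_rd_num exec_bind_eval_penalty
  exec_bind_wr exec_bind_release exec_bind_if exec_bind_assoc

text \<open>The invariant speaks of the memory only. The bound \<open>T\<close> is relative to the
  start of an iteration, so that iterations add up; the extra 1 is the tick of the loop.\<close>

lemma exec_for_each:
  assumes "P a M" "a \<le> b"
    and step: "\<And>i M t. a \<le> i \<Longrightarrow> i < b \<Longrightarrow> P i M \<Longrightarrow> dom M \<in> D \<Longrightarrow>
      exec D (f i) (\<lambda>_ M' t'. P (Suc i) M' \<and> t' \<le> t + T) M t"
  shows "exec D (for_each [a..<b] f) (\<lambda>_ M' t'. P b M' \<and> t' \<le> t + (b - a) * (T + 1)) M t"
  using assms(2,1) step
proof (induction a arbitrary: M t rule: inc_induct)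
  case base
  then show ?case by (simp add: exec_return)
next
  case (step a)
  have "[a..<b] = a # [Suc a..<b]" using step.hyps by (simp add: upt_conv_Cons)
  moreover have "exec D (State_Monad.bind (f a) (\<lambda>_. for_each [Suc a..<b] f))
      (\<lambda>_ M' t'. P b M' \<and> t' \<le> t + (b - a) * (T + 1)) M (t + 1)"
  proof (rule exec_dom, rule exec_bind)
    assume "dom M \<in> D"
    show "exec D (f a) (\<lambda>_ M' t'. P (Suc a) M' \<and> t' \<le> t + 1 + T) M (t + 1)"
      using step.prems(2)[OF order_refl _ step.prems(1) \<open>dom M \<in> D\<close>, of "t + 1"] step.hyps by simp
  next
    fix M' t' assume 1: "P (Suc a) M' \<and> t' \<le> t + 1 + T"
    have "exec D (for_each [Suc a..<b] f) (\<lambda>_ M'' t''. P b M'' \<and> t'' \<le> t' + (b - Suc a) * (T + 1)) M' t'"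
      using 1 step.prems(2) by (intro step.IH) auto
    then show "exec D (for_each [Suc a..<b] f) (\<lambda>_ M'' t''. P b M'' \<and> t'' \<le> t + (b - a) * (T + 1)) M' t'"
    proof (rule exec_conseq)
      fix M'' t'' assume "P b M'' \<and> t'' \<le> t' + (b - Suc a) * (T + 1)"
      moreover have "(b - a) * (T + 1) = (b - Suc a) * (T + 1) + (T + 1)"
        using step.hyps by (metis Suc_diff_Suc add.commute mult_Suc)
      ultimately show "P b M'' \<and> t'' \<le> t + (b - a) * (T + 1)" using 1 by linarith
    qed
  qed
  ultimately show ?case by (simp add: exec_bind_tick)
qed

section \<open>Heaps\<close>

text \<open>Keys and items enter as whole arrays because \<open>heap_ok\<close> also speaks of their
  unoccupied part. Position cells enter only for members, since the array
  \<open>TransferPos q\<close> is shared by all heaps \<open>Transfer p q\<close>.\<close>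

definition heap_cells :: "heap_id \<Rightarrow> nat set \<Rightarrow> cell set" where
  "heap_cells h A = range (Key h) \<union> range (Item h) \<union> pos_cell h ` A"

text \<open>Mutually inverse items and positions make every swap stay within the cells of the heap
  and let a deletion find its unit. The last clause is the source of the space bound: it shows that
  a deletion really frees a slot.\<close>

definition heap_ok :: "(cell \<rightharpoonup> val) \<Rightarrow> heap_id \<Rightarrow> nat set \<Rightarrow> bool" where
  "heap_ok M h A \<longleftrightarrow>
     (\<forall>i < card A. ix M (Item h i) \<in> A \<and> ix M (pos_cell h (ix M (Item h i))) = i) \<and>
     (\<forall>d \<in> A. ix M (pos_cell h d) < card A \<and> ix M (Item h (ix M (pos_cell h d))) = d) \<and>
     (\<forall>i \<ge> card A. M (Key h i) = None \<and> M (Item h i) = None)"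

lemma pos_cell_simps [simp]:
  "pos_cell h d = pos_cell h d' \<longleftrightarrow> d = d'"
  "pos_cell h d \<noteq> Key h' i" "pos_cell h d \<noteq> Item h' i"
  "Key h' i \<noteq> pos_cell h d" "Item h' i \<noteq> pos_cell h d"
  by (cases h; auto)+

lemma heap_ok_cong:
  assumes "\<And>c. c \<in> heap_cells h A \<Longrightarrow> M' c = M c"
  shows "heap_ok M' h A \<longleftrightarrow> heap_ok M h A"
proof -
  have 1: "M' (Key h i) = M (Key h i)" "M' (Item h i) = M (Item h i)" for i
    using assms by (auto simp: heap_cells_def)
  have 2: "M' (pos_cell h d) = M (pos_cell h d)" if "d \<in> A" for d
    using assms that by (auto simp: heap_cells_def)
  show ?thesis unfolding heap_ok_def by (auto simp: 1 2)
qed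

section \<open>Swaps, sifts, insertion and deletion\<close>

definition swap_mem :: "heap_id \<Rightarrow> nat \<Rightarrow> nat \<Rightarrow> (cell \<rightharpoonup> val) \<Rightarrow> (cell \<rightharpoonup> val)" where
  "swap_mem h i j M = M(Key h i \<mapsto> Num (num (the (M (Key h j)))), Key h j \<mapsto> Num (num (the (M (Key h i)))),
     Item h i \<mapsto> Idx (ix M (Item h j)), Item h j \<mapsto> Idx (ix M (Item h i)),
     pos_cell h (ix M (Item h j)) \<mapsto> Idx i, pos_cell h (ix M (Item h i)) \<mapsto> Idx j)"

definition heap_room :: "cell set \<Rightarrow> heap_id \<Rightarrow> nat set \<Rightarrow> bool" where
  "heap_room V h A \<longleftrightarrow> (\<forall>i < card A. Key h i \<in> V \<and> Item h i \<in> V) \<and> (\<forall>d \<in> A. pos_cell h d \<in> V)"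

text \<open>Items and positions are inverse bijections, and a swap composes them with a
  transposition. The case \<open>i = j\<close> is included because a deletion of the last entry
  swaps it with itself.\<close>

lemma heap_ok_swap:
  assumes "heap_ok M h A" "i < card A" "j < card A"
  shows "heap_ok (swap_mem h i j M) h A"
    and "c \<notin> heap_cells h A \<Longrightarrow> swap_mem h i j M c = M c"
    and "ix (swap_mem h i j M) (Item h j) = ix M (Item h i)"
    and "ix (swap_mem h i j M) (pos_cell h (ix M (Item h i))) = j"
proof -
  have inj: "ix M (Item h a) = ix M (Item h b) \<longleftrightarrow> a = b" if "a < card A" "b < card A" for a b
    using assms(1) that unfolding heap_ok_def by metis
  have pos: "ix M (pos_cell h d) = a \<longleftrightarrow> d = ix M (Item h a)" if "a < card A" "d \<in> A" for a d
    using assms(1) that unfolding heap_ok_def by metis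
  show "heap_ok (swap_mem h i j M) h A"
    using assms(1) unfolding heap_ok_def
  proof (elim conjE, intro conjI allI impI ballI)
    assume 1: "\<forall>i<card A. ix M (Item h i) \<in> A \<and> ix M (pos_cell h (ix M (Item h i))) = i"
      "\<forall>d\<in>A. ix M (pos_cell h d) < card A \<and> ix M (Item h (ix M (pos_cell h d))) = d"
      "\<forall>i\<ge>card A. M (Key h i) = None \<and> M (Item h i) = None"
    fix a
    show "ix (swap_mem h i j M) (Item h a) \<in> A"
      "ix (swap_mem h i j M) (pos_cell h (ix (swap_mem h i j M) (Item h a))) = a" if "a < card A"
      using 1(1) assms(2,3) that by (auto simp: swap_mem_def inj)
    show "ix (swap_mem h i j M) (pos_cell h a) < card A"
      "ix (swap_mem h i j M) (Item h (ix (swap_mem h i j M) (pos_cell h a))) = a" if "a \<in> A"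
      using 1(2) assms(2,3) that by (auto simp: swap_mem_def pos)
    show "swap_mem h i j M (Key h a) = None" "swap_mem h i j M (Item h a) = None" if "card A \<le> a"
      using 1(3) assms(2,3) that by (auto simp: swap_mem_def)
  qed
  show "c \<notin> heap_cells h A \<Longrightarrow> swap_mem h i j M c = M c"
    using assms unfolding heap_ok_def swap_mem_def heap_cells_def by auto
qed (use assms in \<open>auto simp: heap_ok_def swap_mem_def\<close>)

lemma exec_heap_swap:
  assumes "heap_ok M h A" "i < card A" "j < card A" "heap_room V h A"
  shows "exec (Pow V) (heap_swap h i j) (\<lambda>_ M' t'. M' = swap_mem h i j M \<and> t' = t + 10) M t"
  unfolding heap_swap_def
  using assms by (intro exec_rules) (auto simp: heap_ok_def heap_room_def swap_mem_def)

text \<open>In the next two lemmas \<open>b\<close> bounds the number of levels between \<open>i\<close> and the end of the sift.\<close>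

lemma exec_sift_up:
  assumes "heap_ok M h A" "i < card A" "i + 1 \<le> 2 ^ b" "heap_room V h A"
  shows "exec (Pow V) (sift_up h i)
    (\<lambda>_ M' t'. heap_ok M' h A \<and> (\<forall>c. c \<notin> heap_cells h A \<longrightarrow> M' c = M c) \<and> t' \<le> t + 13 * b + 1) M t"
  using assms
proof (induction b arbitrary: i M t)
  case 0
  then show ?case by (subst sift_up.simps) (auto intro!: exec_rules)
next
  case (Suc b)
  let ?p = "(i - 1) div 2"
  \<comment> \<open>Passing to the parent halves \<open>i + 1\<close>. A level costs 13 steps: a
    tick, two reads and a swap of 10.\<close>
  have p: "?p < card A" "?p + 1 \<le> 2 ^ b" if "i \<noteq> 0" using Suc.prems that by auto
  have swap: "exec (Pow V) (State_Monad.bind (heap_swap h i ?p) (\<lambda>_. sift_up h ?p))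
    (\<lambda>_ M' t'. heap_ok M' h A \<and> (\<forall>c. c \<notin> heap_cells h A \<longrightarrow> M' c = M c) \<and> t' \<le> t + 13 * Suc b + 1) M (t + 3)"
    if "i \<noteq> 0"
  proof (rule exec_bind[OF exec_heap_swap])
    fix r :: unit and M' t' assume M': "M' = swap_mem h i ?p M \<and> t' = t + 3 + 10"
    show "exec (Pow V) (sift_up h ?p)
      (\<lambda>_ M' t'. heap_ok M' h A \<and> (\<forall>c. c \<notin> heap_cells h A \<longrightarrow> M' c = M c) \<and> t' \<le> t + 13 * Suc b + 1) M' t'"
      using M' heap_ok_swap[OF Suc.prems(1,2) p(1)[OF that]] p that Suc.prems
      by (intro exec_conseq[OF Suc.IH]) auto
  qed (use Suc.prems p that in auto)
  show ?case
    using Suc.prems swap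
    by (subst sift_up.simps) (auto intro!: exec_rules simp: numeral_3_eq_3)
qed

lemma exec_sift_down:
  assumes "heap_ok M h A" "i < card A" "card A \<le> (i + 1) * 2 ^ b" "heap_room V h A"
  shows "exec (Pow V) (sift_down h (card A) i)
    (\<lambda>_ M' t'. heap_ok M' h A \<and> (\<forall>c. c \<notin> heap_cells h A \<longrightarrow> M' c = M c) \<and> t' \<le> t + 15 * b + 1) M t"
  using assms
proof (induction b arbitrary: i M t)
  case 0
  then show ?case by (subst sift_down.simps) (auto intro!: exec_rules)
next
  case (Suc b)
  let ?Q = "\<lambda>(_::unit) M' t'. heap_ok M' h A \<and> (\<forall>c. c \<notin> heap_cells h A \<longrightarrow> M' c = M c) \<and> t' \<le> t + 15 * Suc b + 1"
  \<comment> \<open>At most five steps precede the swap: the tick, two reads to compare the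
    children, two to compare with the smaller one. With the swap this is 15 for each level.\<close>
  have swap: "exec (Pow V) (State_Monad.bind (heap_swap h i c) (\<lambda>_. sift_down h (card A) c)) ?Q M t'"
    if "c = 2 * i + 1 \<or> c = 2 * i + 2" "c < card A" "t' \<le> t + 5" for c t'
  proof (rule exec_bind[OF exec_heap_swap])
    fix r :: unit and M' t'' assume M': "M' = swap_mem h i c M \<and> t'' = t' + 10"
    \<comment> \<open>Either child satisfies \<open>c + 1 >= 2 * (i + 1)\<close>, which pays for one
      factor 2.\<close>
    have "2 * (i + 1) * 2 ^ b \<le> (c + 1) * 2 ^ b" using that(1) by (intro mult_right_mono) auto
    then have "card A \<le> (c + 1) * 2 ^ b" using Suc.prems(3) by (simp add: algebra_simps)
    then show "exec (Pow V) (sift_down h (card A) c) ?Q M' t''"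
      using M' heap_ok_swap[OF Suc.prems(1,2) that(2)] that Suc.prems
      by (intro exec_conseq[OF Suc.IH]) auto
  qed (use Suc.prems that in auto)
  show ?case
    using Suc.prems swap
    by (subst sift_down.simps) (auto intro!: exec_rules simp: right_smaller_def Let_def)
qed

text \<open>Appending the entry already yields \<open>heap_ok\<close> for the enlarged set; sifting
  is then a sequence of swaps, each of which preserves it. Strictness of
  \<open>card A < 2 ^ b\<close> leaves room for the new entry.\<close>

lemma exec_heap_insert:
  assumes "heap_ok M h A" "finite A" "d \<notin> A" "card A < 2 ^ b" "heap_room V h (insert d A)"
  shows "exec (Pow V) (heap_insert h (card A) d key)
    (\<lambda>_ M' t'. heap_ok M' h (insert d A) \<and> (\<forall>c. c \<notin> heap_cells h (insert d A) \<longrightarrow> M' c = M c) \<and>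
       t' \<le> t + 13 * b + 4) M t"
proof -
  let ?M = "M(Key h (card A) \<mapsto> Num key, Item h (card A) \<mapsto> Idx d, pos_cell h d \<mapsto> Idx (card A))"
  have ok: "heap_ok ?M h (insert d A)"
    using assms(1-3) unfolding heap_ok_def by (auto simp: less_Suc_eq)
  have room: "Key h (card A) \<in> V" "Item h (card A) \<in> V" "pos_cell h d \<in> V"
    using assms unfolding heap_room_def by auto
  have "exec (Pow V) (sift_up h (card A)) (\<lambda>_ M' t'. heap_ok M' h (insert d A) \<and>
      (\<forall>c. c \<notin> heap_cells h (insert d A) \<longrightarrow> M' c = ?M c) \<and> t' \<le> t + 3 + 13 * b + 1) ?M (t + 3)"
    by (rule exec_sift_up[OF ok, unfolded add.assoc[symmetric]]) (use assms in auto)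
  then have "exec (Pow V) (sift_up h (card A)) (\<lambda>_ M' t'. heap_ok M' h (insert d A) \<and>
      (\<forall>c. c \<notin> heap_cells h (insert d A) \<longrightarrow> M' c = M c) \<and> t' \<le> t + 13 * b + 4) ?M (t + 3)"
    by (rule exec_conseq) (auto simp: heap_cells_def)
  then show ?thesis
    unfolding heap_insert_def using room by (intro exec_rules) (auto simp: numeral_3_eq_3)
qed

lemma exec_heap_delete:
  assumes "heap_ok M h A" "finite A" "d \<in> A" "card A \<le> 2 ^ b" "heap_room V h A"
  shows "exec (Pow V) (heap_delete h (card A) d)
    (\<lambda>_ M' t'. heap_ok M' h (A - {d}) \<and> (\<forall>c. c \<notin> heap_cells h A \<longrightarrow> M' c = M c) \<and>
       t' \<le> t + 28 * b + 16) M t"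
proof -
  let ?m = "card A - 1" and ?i = "ix M (pos_cell h d)" and ?A = "A - {d}"
  let ?M = "swap_mem h ?i ?m M"
  let ?N = "?M(Key h ?m := None, Item h ?m := None, pos_cell h d := None)"
  have card: "card ?A = ?m" "0 < card A" using assms by (auto simp: card_gt_0_iff)
  have i: "?i < card A" "ix M (Item h ?i) = d" using assms unfolding heap_ok_def by auto
  have m: "?m < card A" using card by auto
  note swap = heap_ok_swap[OF assms(1) i(1) m, unfolded i(2)]
  have ok: "heap_ok ?N h ?A"
    unfolding heap_ok_def card
  proof (intro conjI allI impI ballI)
    fix i assume "i < ?m"
    then have "i < card A" "i \<noteq> ?m" by auto
    then have *: "ix ?M (Item h i) \<in> A" "ix ?M (pos_cell h (ix ?M (Item h i))) = i"
      using swap(1) unfolding heap_ok_def by auto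
    then have "ix ?M (Item h i) \<noteq> d" using swap(4) \<open>i \<noteq> ?m\<close> by metis
    then show "ix ?N (Item h i) \<in> ?A" "ix ?N (pos_cell h (ix ?N (Item h i))) = i"
      using * \<open>i \<noteq> ?m\<close> by auto
  next
    fix e assume e: "e \<in> ?A"
    then have *: "ix ?M (pos_cell h e) < card A" "ix ?M (Item h (ix ?M (pos_cell h e))) = e"
      using swap(1) unfolding heap_ok_def by auto
    then have "ix ?M (pos_cell h e) \<noteq> ?m" using swap(3) e by (metis DiffE singletonI)
    then show "ix ?N (pos_cell h e) < ?m" "ix ?N (Item h (ix ?N (pos_cell h e))) = e"
      using * e by auto
  next
    fix i assume "?m \<le> i"
    then have "i = ?m \<or> i \<ge> card A" using card by linarith
    then show "?N (Key h i) = None" "?N (Item h i) = None"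
      using swap(1) unfolding heap_ok_def by auto
  qed
  have room: "heap_room V h ?A" using assms card unfolding heap_room_def by auto
  have frame: "?N c = M c" if "c \<notin> heap_cells h A" for c
    using swap(2)[OF that] that assms(3) by (auto simp: heap_cells_def)
  let ?Q = "\<lambda>(_::unit) M' t'. heap_ok M' h ?A \<and> (\<forall>c. c \<notin> heap_cells h A \<longrightarrow> M' c = M c) \<and>
    t' \<le> t + 28 * b + 16"
  \<comment> \<open>The 14 steps so far are one read, the swap and three releases. Which of the two
    sifts moves anything depends on the order of the keys, which \<open>heap_ok\<close> does not
    record, so both are charged in full: \<open>13 * b + 15 * b\<close>.\<close>
  have sift: "exec (Pow V) (State_Monad.bind (sift_up h ?i) (\<lambda>_. sift_down h (card ?A) ?i)) ?Q ?N (t + 14)"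
    if less: "?i < ?m"
  proof (rule exec_bind)
    show "exec (Pow V) (sift_up h ?i) (\<lambda>_ M' t'. heap_ok M' h ?A \<and>
        (\<forall>c. c \<notin> heap_cells h ?A \<longrightarrow> M' c = ?N c) \<and> t' \<le> t + 14 + 13 * b + 1) ?N (t + 14)"
      by (rule exec_sift_up[OF ok]) (use room less assms card in auto)
  next
    fix r :: unit and M' t' assume M': "heap_ok M' h ?A \<and>
        (\<forall>c. c \<notin> heap_cells h ?A \<longrightarrow> M' c = ?N c) \<and> t' \<le> t + 14 + 13 * b + 1"
    have "card ?A \<le> (?i + 1) * 2 ^ b" using card assms(4) by (simp add: trans_le_add1)
    then have "exec (Pow V) (sift_down h (card ?A) ?i) (\<lambda>_ M'' t''. heap_ok M'' h ?A \<and>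
        (\<forall>c. c \<notin> heap_cells h ?A \<longrightarrow> M'' c = M' c) \<and> t'' \<le> t' + 15 * b + 1) M' t'"
      using M' room less card by (intro exec_sift_down) auto
    then show "exec (Pow V) (sift_down h (card ?A) ?i) ?Q M' t'"
    proof (rule exec_conseq)
      fix r :: unit and M'' t''
      assume M'': "heap_ok M'' h ?A \<and> (\<forall>c. c \<notin> heap_cells h ?A \<longrightarrow> M'' c = M' c) \<and> t'' \<le> t' + 15 * b + 1"
      have "heap_cells h ?A \<subseteq> heap_cells h A" by (auto simp: heap_cells_def)
      then have "\<forall>c. c \<notin> heap_cells h A \<longrightarrow> M'' c = M c" using M' M'' frame by (metis subsetD)
      then show "?Q r M'' t''" using M' M'' by auto
    qed
  qed
  show ?thesis
    unfolding heap_delete_def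
  proof (rule exec_bind_rd_idx, rule exec_bind[OF exec_heap_swap[OF assms(1) i(1) m assms(5)]],
      intro exec_bind_release, goal_cases)
    case (1 r M' t')
    then show ?case using sift ok frame card by (intro exec_if) (auto intro!: exec_rules simp: eval_nat_numeral)
  qed
qed

section \<open>The memory layout\<close>

fun valid_heap :: "lbdd \<Rightarrow> heap_id \<Rightarrow> bool" where
  "valid_heap I Pending = True"
| "valid_heap I (Transfer p q) = (p < num_centers I \<and> q < num_centers I \<and> p \<noteq> q)"

fun heap_cell :: "cell \<Rightarrow> bool" where
  "heap_cell (Key h i) = True"
| "heap_cell (Item h i) = True"
| "heap_cell (PendingPos d) = True"
| "heap_cell (TransferPos q d) = True"
| "heap_cell _ = False"

lemma heap_cells_heap_cell: "c \<in> heap_cells h A \<Longrightarrow> heap_cell c"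
  by (cases h) (auto simp: heap_cells_def)

lemma pos_cell_eqD: "pos_cell h d = pos_cell h' d' \<Longrightarrow> d = d'"
  by (cases h; cases h') auto

text \<open>The second clause is separation: \<open>Transfer p q\<close> and
  \<open>Transfer p' q\<close> use the same position array, so an update of one could overwrite an
  entry of the other if they had a unit in common.\<close>

definition heaps :: "lbdd \<Rightarrow> (heap_id \<Rightarrow> nat set) \<Rightarrow> (cell \<rightharpoonup> val) \<Rightarrow> bool" where
  "heaps I H M \<longleftrightarrow>
     (\<forall>h. valid_heap I h \<longrightarrow> H h \<subseteq> {..<num_units I} \<and> heap_ok M h (H h)) \<and>
     (\<forall>h h' d. valid_heap I h \<longrightarrow> valid_heap I h' \<longrightarrow> h \<noteq> h' \<longrightarrow> d \<in> H h \<longrightarrow> d \<in> H h' \<longrightarrow>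
        pos_cell h d \<noteq> pos_cell h' d)"

lemma heaps_cong:
  "heaps I H M" if "heaps I H' M'" "\<And>h. valid_heap I h \<Longrightarrow> H h = H' h" "\<And>c. heap_cell c \<Longrightarrow> M c = M' c"
proof -
  have "heap_ok M h (H' h) \<longleftrightarrow> heap_ok M' h (H' h)" for h
    by (rule heap_ok_cong) (auto intro!: that(3) dest: heap_cells_heap_cell)
  then show ?thesis using that(1,2) unfolding heaps_def by simp
qed

text \<open>A frame rule. Key and item cells carry the name of their heap, and position cells of
  different heaps are kept apart by \<open>disj\<close> for the new contents and by separation for
  the old ones.\<close>

lemma heaps_update:
  assumes H: "heaps I H M" and h: "valid_heap I h" and A: "A \<subseteq> {..<num_units I}" "heap_ok M' h A"
    and frame: "\<And>c. c \<notin> heap_cells h (A \<union> H h) \<Longrightarrow> M' c = M c"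
    and disj: "\<And>h' d. valid_heap I h' \<Longrightarrow> h' \<noteq> h \<Longrightarrow> d \<in> A \<Longrightarrow> d \<in> H h' \<Longrightarrow> pos_cell h d \<noteq> pos_cell h' d"
  shows "heaps I (H(h := A)) M'"
proof -
  have "heap_ok M' h' (H h')" if h': "valid_heap I h'" "h' \<noteq> h" for h'
  proof -
    have "heap_cells h' (H h') \<inter> heap_cells h (A \<union> H h) = {}"
    proof -
      have "pos_cell h' d' \<noteq> pos_cell h d" if "d' \<in> H h'" "d \<in> A \<union> H h" for d d'
        using that disj[OF h'] H h h' pos_cell_eqD[of h' d' h d] unfolding heaps_def by (metis Un_iff)
      then show ?thesis using h' unfolding heap_cells_def by (auto simp: image_iff)
    qed
    then have "heap_ok M' h' (H h') \<longleftrightarrow> heap_ok M h' (H h')"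
      by (intro heap_ok_cong frame) auto
    then show ?thesis using H h' unfolding heaps_def by auto
  qed
  then show ?thesis
    using H h A disj unfolding heaps_def by (auto; metis)
qed

text \<open>Only the key and item slots of transfer heaps depend on the loads \<open>L\<close>; all
  other arrays have a fixed length. In the length of the edge arrays the summand
  \<open>num_centers I\<close> is for the edges into the in-copy of a path graph.\<close>

fun allowed :: "lbdd \<Rightarrow> (nat \<Rightarrow> nat) \<Rightarrow> cell \<Rightarrow> bool" where
  "allowed I L (Cost d s) = (d < num_units I \<and> s < num_centers I)"
| "allowed I L (Free s) = (s < num_centers I)"
| "allowed I L (Over s) = (s < num_centers I)"
| "allowed I L (Load s) = (s < num_centers I)"
| "allowed I L (Center d) = (d < num_units I)"
| "allowed I L (Smin d) = (d < num_units I)"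
| "allowed I L Objective = True"
| "allowed I L (Key Pending i) = (i < num_units I)"
| "allowed I L (Item Pending i) = (i < num_units I)"
| "allowed I L (Key (Transfer p q) i) = (p < num_centers I \<and> q < num_centers I \<and> p \<noteq> q \<and> i < L p)"
| "allowed I L (Item (Transfer p q) i) = (p < num_centers I \<and> q < num_centers I \<and> p \<noteq> q \<and> i < L p)"
| "allowed I L (PendingPos d) = (d < num_units I)"
| "allowed I L (TransferPos q d) = (q < num_centers I \<and> d < num_units I)"
| "allowed I L NumEdges = True"
| "allowed I L (EdgeSrc e) = (e < num_units I * num_centers I + num_centers I)"
| "allowed I L (EdgeDst e) = (e < num_units I * num_centers I + num_centers I)"
| "allowed I L (EdgeCost e) = (e < num_units I * num_centers I + num_centers I)"
| "allowed I L (EdgeUnit e) = (e < num_units I * num_centers I + num_centers I)"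
| "allowed I L (Reached v) = (v \<le> num_centers I)"
| "allowed I L (Dist v) = (v \<le> num_centers I)"
| "allowed I L (PredEdge v) = (v \<le> num_centers I)"

definition cells :: "lbdd \<Rightarrow> (nat \<Rightarrow> nat) \<Rightarrow> cell set" where
  "cells I L = {c. allowed I L c}"

lemma in_cells [simp]: "c \<in> cells I L \<longleftrightarrow> allowed I L c"
  by (simp add: cells_def)

lemma allowed_mono: "allowed I L c \<Longrightarrow> (\<And>p. L p \<le> L' p) \<Longrightarrow> allowed I L' c"
  by (induction I L c rule: allowed.induct) (auto intro: less_le_trans)

text \<open>Edges leave only the centers that hold a unit, hence the auxiliary graphs fit into \<open>O(n k)\<close> cells
  even if there are more centers than units.\<close>

lemma card_cells:
  assumes "(\<Sum>p<num_centers I. L p) \<le> num_units I" "num_units I \<ge> 1" "num_centers I \<ge> 1"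
  shows "finite (cells I L)" "card (cells I L) \<le> 30 * (num_units I * num_centers I)"
proof -
  define n k where "n = num_units I" and "k = num_centers I"
  define E where "E = n * k + k"
  let ?T = "Sigma {..<k} (\<lambda>p. {..<k} \<times> {..<L p})"
  define parts where "parts =
    [(\<lambda>(d, s). Cost d s) ` ({..<n} \<times> {..<k}), Free ` {..<k}, Over ` {..<k}, Load ` {..<k},
     Center ` {..<n}, Smin ` {..<n}, {Objective}, Key Pending ` {..<n}, Item Pending ` {..<n},
     (\<lambda>(p, q, i). Key (Transfer p q) i) ` ?T, (\<lambda>(p, q, i). Item (Transfer p q) i) ` ?T,
     PendingPos ` {..<n}, (\<lambda>(q, d). TransferPos q d) ` ({..<k} \<times> {..<n}), {NumEdges},
     EdgeSrc ` {..<E}, EdgeDst ` {..<E}, EdgeCost ` {..<E}, EdgeUnit ` {..<E},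
     Reached ` {..k}, Dist ` {..k}, PredEdge ` {..k}]"
  have sub: "cells I L \<subseteq> \<Union> (set parts)"
  proof
    fix c assume "c \<in> cells I L"
    then have "allowed I L c" by simp
    then show "c \<in> \<Union> (set parts)"
      by (cases "(I, L, c)" rule: allowed.cases)
         (simp_all add: parts_def n_def k_def E_def image_iff)
  qed
  have fin: "\<forall>X\<in>set parts. finite X" unfolding parts_def by auto
  then show "finite (cells I L)" using sub by (meson finite_Union finite_set finite_subset)
  \<comment> \<open>The k target indices for \<open>p\<close> have \<open>L p\<close> slots each.
    Summing the loads instead of bounding each by n gives k n in place of k^2 n.\<close>
  have T: "card ?T \<le> k * n"
  proof -
    have "card ?T = (\<Sum>p<k. k * L p)" by (subst card_SigmaI) auto
    also have "\<dots> = k * (\<Sum>p<k. L p)" by (simp add: sum_distrib_left)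
    also have "\<dots> \<le> k * n" using assms(1) by (simp add: n_def k_def)
    finally show ?thesis .
  qed
  have Un: "card (\<Union> (set xs)) \<le> sum_list (map card xs)" for xs :: "cell set list"
  proof (induction xs)
    case (Cons X xs)
    then show ?case using card_Un_le[of X "\<Union> (set xs)"] by simp
  qed simp
  have ci: "card (f ` A) \<le> b" if "finite A" "card A \<le> b" for f :: "'x \<Rightarrow> cell" and A b
    using card_image_le[OF that(1), of f] that(2) by simp
  have "list_all2 (\<lambda>X b. card X \<le> b) parts
    [n * k, k, k, k, n, n, 1, n, n, k * n, k * n, n, k * n, 1, E, E, E, E, k + 1, k + 1, k + 1]"
    unfolding parts_def list_all2_Cons list_all2_Nil
    by (intro conjI ci T TrueI) (simp_all add: finite_SigmaI)
  then have "sum_list (map card parts) \<le> sum_list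
    [n * k, k, k, k, n, n, 1, n, n, k * n, k * n, n, k * n, 1, E, E, E, E, k + 1, k + 1, k + 1]"
    by (induction rule: list_all2_induct) auto
  moreover have "card (cells I L) \<le> card (\<Union> (set parts))"
    using sub fin by (intro card_mono) auto
  moreover have "sum_list
    [n * k, k, k, k, n, n, 1, n, n, k * n, k * n, n, k * n, 1, E, E, E, E, k + 1, k + 1, k + 1] =
    8 * (n * k) + 10 * k + 5 * n + 5" unfolding E_def by simp
  \<comment> \<open>Each of n, k and 1 is at most n k, so that the sum is at most 28 n k.\<close>
  moreover have "n * 1 \<le> n * k" "1 * k \<le> n * k" "1 * 1 \<le> n * k"
    by (rule mult_le_mono; use assms(2,3) in \<open>simp add: n_def k_def\<close>)+
  ultimately show "card (cells I L) \<le> 30 * (num_units I * num_centers I)"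
    using Un[of parts] unfolding n_def[symmetric] k_def[symmetric] mult_1 mult_1_right by linarith
qed

section \<open>Allotments\<close>

definition load :: "(nat \<rightharpoonup> nat) \<Rightarrow> nat \<Rightarrow> nat" where
  "load a p = card {d. a d = Some p}"

lemma sum_load_le:
  assumes "dom a \<subseteq> {..<n}"
  shows "(\<Sum>p<k. load a p) \<le> n"
proof -
  have fin: "finite {d. a d = Some p}" for p
    by (rule finite_subset[of _ "{..<n}"]) (use assms in auto)
  have "(\<Sum>p<k. load a p) = card (\<Union>p<k. {d. a d = Some p})"
    unfolding load_def by (subst card_UN_disjoint) (auto simp: fin)
  also have "\<dots> \<le> card {..<n}" using assms by (intro card_mono) auto
  finally show ?thesis by simp
qed

lemma load_le:
  assumes "dom a \<subseteq> {..<n}" shows "load a p \<le> n"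
  using card_mono[of "{..<n}" "{d. a d = Some p}"] assms unfolding load_def by auto

fun contents :: "(nat \<rightharpoonup> nat) \<Rightarrow> nat set \<Rightarrow> heap_id \<Rightarrow> nat set" where
  "contents a B Pending = B"
| "contents a B (Transfer p q) = {d. a d = Some p}"

text \<open>\<open>a\<close> is the current allotment and \<open>B\<close> the set of pending units.\<close>

definition state_ok :: "lbdd \<Rightarrow> (nat \<rightharpoonup> nat) \<Rightarrow> nat set \<Rightarrow> (cell \<rightharpoonup> val) \<Rightarrow> bool" where
  "state_ok I a B M \<longleftrightarrow>
     heaps I (contents a B) M \<and>
     dom a \<subseteq> {..<num_units I} \<and> ran a \<subseteq> {..<num_centers I} \<and>
     B \<subseteq> {..<num_units I} \<and> dom a \<inter> B = {} \<and>
     (\<forall>d p. a d = Some p \<longrightarrow> ix M (Center d) = p) \<and>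
     (\<forall>p < num_centers I. ix M (Load p) = load a p) \<and>
     (\<forall>d \<in> B. ix M (Smin d) < num_centers I) \<and>
     dom M \<subseteq> cells I (load a)"

text \<open>The cells whose contents \<open>state_ok\<close> constrains. Any other allowed cell can
  be overwritten without disturbing the invariant.\<close>

fun allot_cell :: "cell \<Rightarrow> bool" where
  "allot_cell (Load p) = True"
| "allot_cell (Center d) = True"
| "allot_cell (Smin d) = True"
| "allot_cell c = heap_cell c"

lemma heap_cell_allot_cell: "heap_cell c \<Longrightarrow> allot_cell c"
  by (cases c) auto

lemma state_ok_cong:
  assumes "state_ok I a B M" "\<And>c. allot_cell c \<Longrightarrow> M' c = M c" "dom M' \<subseteq> cells I (load a)"
  shows "state_ok I a B M'"
proof -
  have "heaps I (contents a B) M'"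
    using assms heaps_cong heap_cell_allot_cell unfolding state_ok_def by metis
  then show ?thesis using assms unfolding state_ok_def by auto
qed

text \<open>The family belongs to the new allotment \<open>a'\<close>, because the heaps leaving
  \<open>p\<close> reach their new length before \<open>Load p\<close> and \<open>Center d\<close>
  are written. Within the loop these heaps differ in size, so that \<open>state_ok\<close> is
  suspended and only \<open>heaps\<close> is maintained.\<close>

lemma exec_add_unit:
  assumes ok: "state_ok I a B M" and d: "a d = None" "d < num_units I" "d \<notin> B"
    and p: "p < num_centers I" and b: "num_units I \<le> 2 ^ b"
  defines "a' \<equiv> a(d \<mapsto> p)"
  shows "exec (Pow (cells I (load a'))) (add_unit I d p)
    (\<lambda>_ M' t'. state_ok I a' B M' \<and> (\<forall>c. \<not> allot_cell c \<longrightarrow> M' c = M c) \<and>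
       t' \<le> t + num_centers I * (13 * b + 6) + 4) M t"
proof -
  \<comment> \<open>The contents of the heaps when the loop arrives at \<open>q\<close>:
    \<open>d\<close> has been inserted for the targets below \<open>q\<close>.\<close>
  define H where "H q h = (case h of Pending \<Rightarrow> B
    | Transfer p' q' \<Rightarrow> if p' = p \<and> q' < q then insert d {d. a d = Some p'} else {d. a d = Some p'})"
    for q h
  define P where "P q M' \<longleftrightarrow> heaps I (H q) M' \<and> (\<forall>c. \<not> heap_cell c \<longrightarrow> M' c = M c)" for q M'
  let ?A = "{d. a d = Some p}" and ?V = "cells I (load a')"
  have card: "card ?A = load a p" by (simp add: load_def)
  have fin: "finite ?A" by (rule finite_subset[of _ "{..<num_units I}"]) (use ok in \<open>auto simp: state_ok_def\<close>)
  have ins: "{e. a' e = Some p} = insert d ?A" unfolding a'_def using d by auto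
  have load': "load a' p = Suc (load a p)" unfolding load_def ins using fin d by simp
  have dom': "dom a' \<subseteq> {..<num_units I}" using ok d unfolding a'_def state_ok_def by auto
  have other: "{e. a' e = Some p'} = {e. a e = Some p'}" if "p' \<noteq> p" for p'
    unfolding a'_def using that d by auto
  have loop: "exec (Pow ?V) (for_each [0..<num_centers I] (\<lambda>q.
       if q = p then State_Monad.return ()
       else do { cq \<leftarrow> rd_num (Cost d q); heap_insert (Transfer p q) (load a p) d (cq - cp) }))
     (\<lambda>_ M' t'. P (num_centers I) M' \<and> t' \<le> t + (num_centers I - 0) * ((13 * b + 5) + 1)) M t" for cp t
  proof (rule exec_for_each)
    have "H 0 h = contents a B h" for h by (cases h) (simp_all add: H_def)
    then have "H 0 = contents a B" by blast
    then show "P 0 M" using ok unfolding P_def state_ok_def by simp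
  next
    fix q M' t assume q: "q < num_centers I" and P: "P q M'"
    show "exec (Pow ?V) (if q = p then State_Monad.return ()
       else do { cq \<leftarrow> rd_num (Cost d q); heap_insert (Transfer p q) (load a p) d (cq - cp) })
      (\<lambda>_ M' t'. P (Suc q) M' \<and> t' \<le> t + (13 * b + 5)) M' t"
    proof (intro exec_if exec_return exec_bind_rd_num)
      \<comment> \<open>\<open>Transfer p p\<close> is not a valid heap, so the contents that
        \<open>H\<close> assigns to it are unconstrained.\<close>
      assume "q = p"
      then have "heaps I (H (Suc q)) M'"
        using P unfolding P_def
        by (auto elim!: heaps_cong simp: H_def less_Suc_eq split: heap_id.split if_splits)
      then show "P (Suc q) M' \<and> t \<le> t + (13 * b + 5)" using P unfolding P_def by simp
    next
      assume "q \<noteq> p"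
      then have v: "valid_heap I (Transfer p q)" using p q by simp
      have Hq: "H q (Transfer p q) = ?A" unfolding H_def by simp
      have hok: "heap_ok M' (Transfer p q) ?A" using P v Hq unfolding P_def heaps_def by metis
      have room: "heap_room ?V (Transfer p q) (insert d ?A)"
        using v d dom' unfolding heap_room_def ins[symmetric] load_def[symmetric] by auto
      \<comment> \<open>Strict, since \<open>d\<close> is a further one of the n units.\<close>
      have small: "card ?A < 2 ^ b"
        using load_le[OF dom', of p] load' b unfolding load_def by simp
      show "exec (Pow ?V) (heap_insert (Transfer p q) (load a p) d (num (the (M' (Cost d q))) - cp))
        (\<lambda>_ M' t'. P (Suc q) M' \<and> t' \<le> t + (13 * b + 5)) M' (t + 1)"
        unfolding card[symmetric]
      proof (rule exec_conseq[OF exec_heap_insert[OF hok fin _ small room]])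
        fix r :: unit and M'' t'
        assume 1: "heap_ok M'' (Transfer p q) (insert d ?A) \<and>
          (\<forall>c. c \<notin> heap_cells (Transfer p q) (insert d ?A) \<longrightarrow> M'' c = M' c) \<and> t' \<le> t + 1 + 13 * b + 4"
        have "heaps I ((H q)(Transfer p q := insert d ?A)) M''"
        proof (rule heaps_update[OF _ v])
          show "heaps I (H q) M'" using P unfolding P_def by simp
          show "insert d ?A \<subseteq> {..<num_units I}" using ins dom' by auto
          show "heap_ok M'' (Transfer p q) (insert d ?A)" using 1 by simp
          show "M'' c = M' c" if "c \<notin> heap_cells (Transfer p q) (insert d ?A \<union> H q (Transfer p q))" for c
            using 1 that Hq by (simp add: insert_absorb)
          \<comment> \<open>Only heaps with the same target share position cells. Those leaving
            another center contain none of the units at \<open>p\<close>, and \<open>d\<close> has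
            no center in \<open>a\<close>.\<close>
          show "pos_cell (Transfer p q) e \<noteq> pos_cell h' e"
            if "valid_heap I h'" "h' \<noteq> Transfer p q" "e \<in> insert d ?A" "e \<in> H q h'" for h' e
            using that d by (cases h') (auto simp: H_def split: if_splits)
        qed
        then have "heaps I (H (Suc q)) M''"
          by (rule heaps_cong) (auto simp: H_def less_Suc_eq split: heap_id.split)
        moreover have "\<forall>c. \<not> heap_cell c \<longrightarrow> M'' c = M c"
          using 1 P heap_cells_heap_cell unfolding P_def by metis
        ultimately show "P (Suc q) M'' \<and> t' \<le> t + (13 * b + 5)" using 1 unfolding P_def by simp
      qed (use d in auto)
    qed
  qed simp
  have Load: "ix M (Load p) = load a p" using ok p unfolding state_ok_def by simp
  have fin': "state_ok I a' B (M'(Load p \<mapsto> Idx (load a p + 1), Center d \<mapsto> Idx p)) \<and>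
     (\<forall>c. \<not> allot_cell c \<longrightarrow> (M'(Load p \<mapsto> Idx (load a p + 1), Center d \<mapsto> Idx p)) c = M c)"
    if P: "P (num_centers I) M'" and dom: "dom M' \<subseteq> cells I (load a')" for M'
  proof -
    let ?M = "M'(Load p \<mapsto> Idx (load a p + 1), Center d \<mapsto> Idx p)"
    have "heaps I (contents a' B) ?M"
    proof (rule heaps_cong)
      show "heaps I (H (num_centers I)) M'" using P unfolding P_def by simp
      show "contents a' B h = H (num_centers I) h" if "valid_heap I h" for h
        using that ins other by (cases h) (auto simp: H_def)
      show "?M c = M' c" if "heap_cell c" for c using that by (cases c) auto
    qed
    moreover have "ran a' \<subseteq> {..<num_centers I}" using ok p unfolding a'_def state_ok_def by (auto simp: ran_def)
    moreover have "ix ?M (Load p') = load a' p'" if "p' < num_centers I" for p'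
      using that ok P load' other[of p'] unfolding P_def state_ok_def by (simp add: load_def)
    moreover have "dom ?M \<subseteq> cells I (load a')" using dom p d by auto
    moreover have "ix ?M (Center e) = c" if "a' e = Some c" for e c
      using that ok P unfolding P_def state_ok_def a'_def by (auto split: if_splits)
    moreover have "ix ?M (Smin e) < num_centers I" if "e \<in> B" for e
      using that ok P unfolding P_def state_ok_def by auto
    moreover have "dom a' \<inter> B = {}" "B \<subseteq> {..<num_units I}"
      using ok d unfolding a'_def state_ok_def by auto
    moreover have "?M c = M c" if "\<not> allot_cell c" for c
      using that P heap_cell_allot_cell[of c] unfolding P_def by auto
    ultimately show ?thesis using dom' unfolding state_ok_def by blast
  qed
  show ?thesis unfolding add_unit_def
    by (rule exec_bind_rd_idx, rule exec_bind_rd_num, unfold Load, rule exec_bind[OF loop], intro exec_rules conjI)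
       (use fin' p d in \<open>auto simp: algebra_simps simp del: fun_upd_apply\<close>)
qed

text \<open>Dual to adding a unit: the run is confined by the old, larger loads. The additional task
  is to show that the final memory fits the smaller loads.\<close>

lemma exec_remove_unit:
  assumes ok: "state_ok I a B M" and d: "a d = Some p" and b: "num_units I \<le> 2 ^ b"
  shows "exec (Pow (cells I (load a))) (remove_unit I d p)
    (\<lambda>_ M' t'. state_ok I (a(d := None)) B M' \<and> (\<forall>c. \<not> allot_cell c \<longrightarrow> M' c = M c) \<and>
       t' \<le> t + num_centers I * (28 * b + 17) + 2) M t"
proof -
  define a' where "a' = a(d := None)"
  define H where "H q h = (case h of Pending \<Rightarrow> B
    | Transfer p' q' \<Rightarrow> if p' = p \<and> q' < q then {d. a d = Some p'} - {d} else {d. a d = Some p'})"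
    for q h
  define P where "P q M' \<longleftrightarrow> heaps I (H q) M' \<and> (\<forall>c. \<not> heap_cell c \<longrightarrow> M' c = M c)" for q M'
  let ?A = "{d. a d = Some p}" and ?V = "cells I (load a)"
  have card: "card ?A = load a p" by (simp add: load_def)
  have fin: "finite ?A" by (rule finite_subset[of _ "{..<num_units I}"]) (use ok in \<open>auto simp: state_ok_def\<close>)
  have p: "p < num_centers I" using ok d unfolding state_ok_def ran_def by auto
  have del: "{e. a' e = Some p} = ?A - {d}" unfolding a'_def using d by auto
  have load': "load a' p = load a p - 1" unfolding load_def del using fin d by simp
  have dom: "dom a \<subseteq> {..<num_units I}" using ok unfolding state_ok_def by auto
  have other: "{e. a' e = Some p'} = {e. a e = Some p'}" if "p' \<noteq> p" for p'
    unfolding a'_def using that d by auto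
  have loop: "exec (Pow ?V) (for_each [0..<num_centers I] (\<lambda>q.
       if q = p then State_Monad.return () else heap_delete (Transfer p q) (load a p) d))
     (\<lambda>_ M' t'. P (num_centers I) M' \<and> t' \<le> t + (num_centers I - 0) * ((28 * b + 16) + 1)) M t" for t
  proof (rule exec_for_each)
    have "H 0 h = contents a B h" for h by (cases h) (simp_all add: H_def)
    then have "H 0 = contents a B" by blast
    then show "P 0 M" using ok unfolding P_def state_ok_def by simp
  next
    fix q M' t assume q: "q < num_centers I" and P: "P q M'"
    show "exec (Pow ?V) (if q = p then State_Monad.return () else heap_delete (Transfer p q) (load a p) d)
      (\<lambda>_ M' t'. P (Suc q) M' \<and> t' \<le> t + (28 * b + 16)) M' t"
    proof (intro exec_if exec_return)
      assume "q = p"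
      then have "heaps I (H (Suc q)) M'"
        using P unfolding P_def
        by (auto elim!: heaps_cong simp: H_def less_Suc_eq split: heap_id.split if_splits)
      then show "P (Suc q) M' \<and> t \<le> t + (28 * b + 16)" using P unfolding P_def by simp
    next
      assume "q \<noteq> p"
      then have v: "valid_heap I (Transfer p q)" using p q by simp
      have Hq: "H q (Transfer p q) = ?A" unfolding H_def by simp
      have hok: "heap_ok M' (Transfer p q) ?A" using P v Hq unfolding P_def heaps_def by metis
      have room: "heap_room ?V (Transfer p q) ?A"
        using v d dom unfolding heap_room_def load_def[symmetric] by auto
      have small: "card ?A \<le> 2 ^ b" using load_le[OF dom, of p] b unfolding load_def by simp
      show "exec (Pow ?V) (heap_delete (Transfer p q) (load a p) d)
        (\<lambda>_ M' t'. P (Suc q) M' \<and> t' \<le> t + (28 * b + 16)) M' t"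
        unfolding card[symmetric]
      proof (rule exec_conseq[OF exec_heap_delete[OF hok fin _ small room]])
        fix r :: unit and M'' t'
        assume 1: "heap_ok M'' (Transfer p q) (?A - {d}) \<and>
          (\<forall>c. c \<notin> heap_cells (Transfer p q) ?A \<longrightarrow> M'' c = M' c) \<and> t' \<le> t + 28 * b + 16"
        have "heaps I ((H q)(Transfer p q := ?A - {d})) M''"
        proof (rule heaps_update[OF _ v])
          show H: "heaps I (H q) M'" using P unfolding P_def by simp
          show "?A - {d} \<subseteq> {..<num_units I}" using dom by auto
          show "heap_ok M'' (Transfer p q) (?A - {d})" using 1 by simp
          have "?A - {d} \<union> ?A = ?A" by auto
          then show "M'' c = M' c" if "c \<notin> heap_cells (Transfer p q) (?A - {d} \<union> H q (Transfer p q))" for c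
            using 1 that Hq by simp
          show "pos_cell (Transfer p q) e \<noteq> pos_cell h' e"
            if "valid_heap I h'" "h' \<noteq> Transfer p q" "e \<in> ?A - {d}" "e \<in> H q h'" for h' e
            using that H v Hq unfolding heaps_def by (metis DiffD1)
        qed
        then have "heaps I (H (Suc q)) M''"
          by (rule heaps_cong) (auto simp: H_def less_Suc_eq split: heap_id.split)
        moreover have "\<forall>c. \<not> heap_cell c \<longrightarrow> M'' c = M c"
          using 1 P heap_cells_heap_cell unfolding P_def by metis
        ultimately show "P (Suc q) M'' \<and> t' \<le> t + (28 * b + 16)" using 1 unfolding P_def by simp
      qed (use d in auto)
    qed
  qed simp
  have Load: "ix M (Load p) = load a p" using ok p unfolding state_ok_def by simp
  have fin': "state_ok I a' B (M'(Load p \<mapsto> Idx (load a p - 1))) \<and>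
     (\<forall>c. \<not> allot_cell c \<longrightarrow> (M'(Load p \<mapsto> Idx (load a p - 1))) c = M c)"
    if P: "P (num_centers I) M'" and domM: "dom M' \<subseteq> cells I (load a)" for M'
  proof -
    let ?M = "M'(Load p \<mapsto> Idx (load a p - 1))"
    have hp: "heaps I (contents a' B) ?M"
    proof (rule heaps_cong)
      show "heaps I (H (num_centers I)) M'" using P unfolding P_def by simp
      show "contents a' B h = H (num_centers I) h" if "valid_heap I h" for h
        using that del other by (cases h) (auto simp: H_def)
      show "?M c = M' c" if "heap_cell c" for c using that by (cases c) auto
    qed
    \<comment> \<open>Here space is reclaimed: by the last clause of \<open>heap_ok\<close>, an
      occupied key or item slot lies below the new size of its heap, which is the new load.\<close>
    have "allowed I (load a') c" if c: "c \<in> dom ?M" for c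
    proof -
      have all: "allowed I (load a) c" using c domM p by (auto split: if_splits)
      have *: "i < load a' p'" if "c = Key (Transfer p' q') i \<or> c = Item (Transfer p' q') i" for p' q' i
      proof -
        have "valid_heap I (Transfer p' q')" using that all by auto
        then have "heap_ok ?M (Transfer p' q') {e. a' e = Some p'}"
          using hp unfolding heaps_def by fastforce
        then show ?thesis using that c unfolding heap_ok_def load_def by (meson domIff linorder_not_less)
      qed
      show ?thesis
      proof (cases c)
        case (Key h i) then show ?thesis using all * by (cases h) auto
      next
        case (Item h i) then show ?thesis using all * by (cases h) auto
      qed (use all in auto)
    qed
    then have "dom ?M \<subseteq> cells I (load a')" by (meson in_cells subsetI)
    moreover have "ran a' \<subseteq> {..<num_centers I}" "dom a' \<subseteq> {..<num_units I}"
      using ok unfolding a'_def state_ok_def by (auto simp: ran_def)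
    moreover have "ix ?M (Load p') = load a' p'" if "p' < num_centers I" for p'
      using that ok P load' other[of p'] unfolding P_def state_ok_def by (simp add: load_def)
    moreover have "ix ?M (Center e) = c" if "a' e = Some c" for e c
      using that ok P unfolding P_def state_ok_def a'_def by (auto split: if_splits)
    moreover have "ix ?M (Smin e) < num_centers I" if "e \<in> B" for e
      using that ok P unfolding P_def state_ok_def by auto
    moreover have "dom a' \<inter> B = {}" "B \<subseteq> {..<num_units I}"
      using ok d unfolding a'_def state_ok_def by auto
    moreover have "?M c = M c" if "\<not> allot_cell c" for c
      using that P heap_cell_allot_cell[of c] unfolding P_def by auto
    ultimately show ?thesis using hp unfolding state_ok_def by blast
  qed
  show ?thesis unfolding remove_unit_def a'_def[symmetric]
    by (rule exec_bind_rd_idx, unfold Load, rule exec_bind[OF loop], intro exec_rules conjI)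
       (use fin' p d in \<open>auto simp: algebra_simps simp del: fun_upd_apply\<close>)
qed

text \<open>No single set of \<open>O(n k)\<close> cells suffices for the whole run, because the heaps grow and shrink with
  the loads of the centers.\<close>

definition footprints :: "lbdd \<Rightarrow> cell set set" where
  "footprints I = {X. \<exists>a. dom a \<subseteq> {..<num_units I} \<and> X \<subseteq> cells I (load a)}"

text \<open>\<open>footprints I\<close> is a union of power sets and in general not closed under
  occupying an allowed cell, so the rule for writes does not apply to it. Code between two changes
  of the allotment is verified in one power set and lifted by this lemma.\<close>

lemma exec_footprints:
  assumes "exec (Pow (cells I (load a))) c Q M t" "dom a \<subseteq> {..<num_units I}" "dom M \<subseteq> cells I (load a)"
  shows "exec (footprints I) c (\<lambda>r M' t'. Q r M' t' \<and> dom M' \<subseteq> cells I (load a)) M t"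
  by (rule exec_conseq[OF exec_mono[OF assms(1)]]) (use assms in \<open>auto simp: footprints_def\<close>)

lemma exec_add_unit':
  assumes ok: "state_ok I a B M" and d: "a d = None" "d < num_units I" "d \<notin> B"
    and p: "p < num_centers I" and b: "num_units I \<le> 2 ^ b"
  shows "exec (footprints I) (add_unit I d p)
    (\<lambda>_ M' t'. state_ok I (a(d \<mapsto> p)) B M' \<and> (\<forall>c. \<not> allot_cell c \<longrightarrow> M' c = M c) \<and>
       t' \<le> t + num_centers I * (13 * b + 6) + 4) M t"
proof (rule exec_conseq[OF exec_footprints[OF exec_add_unit[OF assms]]])
  have "finite {e. (a(d \<mapsto> p)) e = Some p'}" for p'
    by (rule finite_subset[of _ "{..<num_units I}"]) (use ok d in \<open>auto simp: state_ok_def split: if_splits\<close>)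
  then have "load a p' \<le> load (a(d \<mapsto> p)) p'" for p'
    unfolding load_def using d by (intro card_mono) auto
  then show "dom M \<subseteq> cells I (load (a(d \<mapsto> p)))"
    using ok allowed_mono[of I "load a" _ "load (a(d \<mapsto> p))"] unfolding state_ok_def by auto
qed (use ok d in \<open>auto simp: state_ok_def\<close>)

text \<open>The new allotment is hidden by an existential quantifier; only its domain is exposed.
  That the domain is preserved keeps the units of the remaining edges of a path allotted.\<close>

lemma exec_transfer_unit:
  assumes ok: "state_ok I a B M" and d: "d \<in> dom a"
    and p: "p < num_centers I" and b: "num_units I \<le> 2 ^ b"
  shows "exec (footprints I) (transfer_unit I d p)
    (\<lambda>_ M' t'. (\<exists>a'. dom a' = dom a \<and> state_ok I a' B M') \<and> (\<forall>c. \<not> allot_cell c \<longrightarrow> M' c = M c) \<and>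
       t' \<le> t + num_centers I * (41 * b + 30)) M t"
proof -
  obtain s where s: "a d = Some s" using d by auto
  have C: "ix M (Center d) = s" "d < num_units I" "d \<notin> B" using ok s unfolding state_ok_def by auto
  have rem: "exec (footprints I) (remove_unit I d s)
    (\<lambda>_ M' t'. state_ok I (a(d := None)) B M' \<and> (\<forall>c. \<not> allot_cell c \<longrightarrow> M' c = M c) \<and>
       t' \<le> t + num_centers I * (28 * b + 17) + 2) M t" for t
    by (rule exec_conseq[OF exec_footprints[OF exec_remove_unit[OF ok s b]]])
       (use ok in \<open>auto simp: state_ok_def\<close>)
  show ?thesis unfolding transfer_unit_def
  proof (rule exec_bind_rd_idx, unfold C(1), rule exec_bind[OF rem])
    fix r :: unit and M' t'
    assume 1: "state_ok I (a(d := None)) B M' \<and> (\<forall>c. \<not> allot_cell c \<longrightarrow> M' c = M c) \<and>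
       t' \<le> t + 1 + num_centers I * (28 * b + 17) + 2"
    \<comment> \<open>The seven steps outside the two loops are charged to the factor k >= 1, whence
      17 + 6 + 7 = 30.\<close>
    have "1 * 7 \<le> num_centers I * 7" using p by (intro mult_right_mono) auto
    then have "num_centers I * (28 * b + 17) + num_centers I * (13 * b + 6) + 7 \<le> num_centers I * (41 * b + 30)"
      by (simp add: algebra_simps)
    moreover have "dom (a(d \<mapsto> p)) = dom a" using d by auto
    ultimately show "exec (footprints I) (add_unit I d p)
      (\<lambda>_ M' t'. (\<exists>a'. dom a' = dom a \<and> state_ok I a' B M') \<and> (\<forall>c. \<not> allot_cell c \<longrightarrow> M' c = M c) \<and>
       t' \<le> t + num_centers I * (41 * b + 30)) M' t'"
      using 1 C p b
      by (intro exec_conseq[OF exec_add_unit'[of I "a(d := None)" B M' d p b]])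
         (auto simp del: dom_fun_upd)
  qed
qed

lemma exec_lift:
  assumes "exec (Pow (cells I (load a))) c Q M t" "state_ok I a B M"
  shows "exec (footprints I) c Q M t"
  by (rule exec_conseq[OF exec_footprints[OF assms(1)]]) (use assms(2) in \<open>auto simp: state_ok_def\<close>)

lemma state_ok_update:
  assumes "state_ok I a B M" "\<not> allot_cell c" "allowed I (load a) c"
  shows "state_ok I a B (M(c \<mapsto> v))"
  using assms by (intro state_ok_cong[OF assms(1)]) (auto simp: state_ok_def)

lemma state_ok_heap_ok:
  "state_ok I a B M \<Longrightarrow> valid_heap I h \<Longrightarrow> heap_ok M h (contents a B h)"
  unfolding state_ok_def heaps_def by blast

section \<open>Auxiliary graphs\<close>

text \<open>\<open>X\<close> is the set from which the units of the edges into the in-copy are taken: the allotted units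
  in a cycle graph, arbitrary dummies in a path graph.\<close>

definition edges_ok :: "lbdd \<Rightarrow> nat set \<Rightarrow> nat set \<Rightarrow> (cell \<rightharpoonup> val) \<Rightarrow> bool" where
  "edges_ok I X D M \<longleftrightarrow> (\<forall>e < ix M NumEdges.
     ix M (EdgeSrc e) < num_centers I \<and> ix M (EdgeDst e) \<le> num_centers I \<and>
     ix M (EdgeUnit e) \<in> (if ix M (EdgeDst e) = num_centers I then X else D))"

lemma exec_add_edge:
  assumes "state_ok I a B M" "edges_ok I X D M"
    and "ix M NumEdges < num_units I * num_centers I + num_centers I"
    and "u < num_centers I" "v \<le> num_centers I" "d \<in> (if v = num_centers I then X else D)"
  shows "exec (Pow (cells I (load a))) (add_edge u v w d)
    (\<lambda>_ M' t'. state_ok I a B M' \<and> edges_ok I X D M' \<and> ix M' NumEdges = Suc (ix M NumEdges) \<and> t' \<le> t + 6) M t"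
  unfolding add_edge_def
proof (intro exec_rules conjI)
  let ?e = "ix M NumEdges"
  let ?M = "M(EdgeSrc ?e \<mapsto> Idx u, EdgeDst ?e \<mapsto> Idx v, EdgeCost ?e \<mapsto> Num w, EdgeUnit ?e \<mapsto> Idx d,
    NumEdges \<mapsto> Idx (?e + 1))"
  show "state_ok I a B ?M" using assms by (intro state_ok_update) auto
  show "edges_ok I X D ?M" using assms by (auto simp: edges_ok_def less_Suc_eq)
qed (use assms in auto)

text \<open>The two bounds on the new edges serve different purposes:
  \<open>load a u * num_centers I\<close> sums to at most n k and gives the space, while
  \<open>num_centers I\<close> sums to k^2 and gives the time. A nonempty center has nonempty heaps,
  so that slot 0 holds an allotted unit.\<close>

lemma exec_add_top_edges:
  assumes ok: "state_ok I a B M" "edges_ok I X (dom a) M" and u: "u < num_centers I"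
    and room: "ix M NumEdges + load a u * num_centers I \<le> num_units I * num_centers I + num_centers I"
    and f: "\<And>v v'. v < num_centers I \<Longrightarrow> f v = Some v' \<Longrightarrow> v' \<le> num_centers I \<and> (v' = num_centers I \<longrightarrow> dom a \<subseteq> X)"
  shows "exec (Pow (cells I (load a))) (add_top_edges I u f)
    (\<lambda>_ M' t'. state_ok I a B M' \<and> edges_ok I X (dom a) M' \<and>
       ix M' NumEdges \<le> ix M NumEdges + load a u * num_centers I \<and>
       ix M' NumEdges \<le> ix M NumEdges + num_centers I \<and>
       t' \<le> t + 9 * num_centers I + 1) M t"
proof -
  let ?k = "num_centers I" and ?V = "cells I (load a)"
  define P where "P v M' \<longleftrightarrow> state_ok I a B M' \<and> edges_ok I X (dom a) M' \<and> ix M' NumEdges \<le> ix M NumEdges + v"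
    for v M'
  have Load: "ix M (Load u) = load a u" using ok u unfolding state_ok_def by simp
  have loop: "exec (Pow ?V) (for_each [0..<?k] (\<lambda>v.
       if v = u then State_Monad.return ()
       else (case f v of
           None \<Rightarrow> State_Monad.return ()
         | Some v' \<Rightarrow> do {
             w \<leftarrow> rd_num (Key (Transfer u v) 0); d \<leftarrow> rd_idx (Item (Transfer u v) 0);
             add_edge u v' w d })))
     (\<lambda>_ M' t'. P ?k M' \<and> t' \<le> t + (?k - 0) * (8 + 1)) M t" if pos: "load a u > 0" for t
  proof (rule exec_for_each)
    show "P 0 M" using ok unfolding P_def by simp
  next
    fix v M' t assume v: "v < ?k" and P: "P v M'"
    then have P': "P (Suc v) M'" unfolding P_def by simp
    show "exec (Pow ?V) (if v = u then State_Monad.return ()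
       else (case f v of
           None \<Rightarrow> State_Monad.return ()
         | Some v' \<Rightarrow> do {
             w \<leftarrow> rd_num (Key (Transfer u v) 0); d \<leftarrow> rd_idx (Item (Transfer u v) 0);
             add_edge u v' w d }))
      (\<lambda>_ M' t'. P (Suc v) M' \<and> t' \<le> t + 8) M' t"
    proof (cases "v = u \<or> f v = None")
      case True
      then have "(if v = u then State_Monad.return ()
         else (case f v of
           None \<Rightarrow> State_Monad.return ()
         | Some v' \<Rightarrow> do {
             w \<leftarrow> rd_num (Key (Transfer u v) 0); d \<leftarrow> rd_idx (Item (Transfer u v) 0);
             add_edge u v' w d })) = State_Monad.return ()" by auto
      then show ?thesis using P' by (simp add: exec_return)
    next
      case False
      then obtain v' where v': "f v = Some v'" and "v \<noteq> u" by auto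
      let ?d = "ix M' (Item (Transfer u v) 0)"
      have "valid_heap I (Transfer u v)" using u v \<open>v \<noteq> u\<close> by simp
      then have "heap_ok M' (Transfer u v) {d. a d = Some u}"
        using state_ok_heap_ok[of I a B M' "Transfer u v"] P unfolding P_def by simp
      then have d: "?d \<in> dom a" using pos unfolding heap_ok_def load_def by auto
      have k: "?k * 1 \<le> load a u * ?k" using pos by (simp add: Suc_leI)
      have "exec (Pow ?V) (add_edge u v' w ?d)
        (\<lambda>_ M'' t'. state_ok I a B M'' \<and> edges_ok I X (dom a) M'' \<and>
           ix M'' NumEdges = Suc (ix M' NumEdges) \<and> t' \<le> t + 1 + 1 + 6) M' (t + 1 + 1)" for w
      proof (rule exec_add_edge)
        show "ix M' NumEdges < num_units I * ?k + ?k" using P v room k unfolding P_def by linarith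
      qed (use P f[OF v v'] d u in \<open>auto simp: P_def\<close>)
      then have "exec (Pow ?V) (add_edge u v' w ?d) (\<lambda>_ M' t'. P (Suc v) M' \<and> t' \<le> t + 8) M' (t + 1 + 1)" for w
        by (rule exec_conseq) (use P in \<open>auto simp: P_def\<close>)
      then show ?thesis using \<open>v \<noteq> u\<close> v' by (simp add: exec_bind_rd_num exec_bind_rd_idx)
    qed
  qed simp
  show ?thesis unfolding add_top_edges_def
  proof (intro exec_bind_rd_idx exec_if exec_return, unfold Load)
    assume "load a u \<noteq> 0"
    then have pos: "load a u > 0" by simp
    then have k: "?k * 1 \<le> load a u * ?k" by (simp add: Suc_leI)
    show "exec (Pow ?V) (for_each [0..<?k] (\<lambda>v.
       if v = u then State_Monad.return ()
       else (case f v of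
           None \<Rightarrow> State_Monad.return ()
         | Some v' \<Rightarrow> do {
             w \<leftarrow> rd_num (Key (Transfer u v) 0); d \<leftarrow> rd_idx (Item (Transfer u v) 0);
             add_edge u v' w d })))
     (\<lambda>_ M' t'. state_ok I a B M' \<and> edges_ok I X (dom a) M' \<and>
       ix M' NumEdges \<le> ix M NumEdges + load a u * ?k \<and>
       ix M' NumEdges \<le> ix M NumEdges + ?k \<and>
       t' \<le> t + 9 * ?k + 1) M (t + 1)"
    proof (rule exec_conseq[OF loop[OF pos]])
      fix r :: unit and M' t' assume 1: "P ?k M' \<and> t' \<le> t + 1 + (?k - 0) * (8 + 1)"
      then have "ix M' NumEdges \<le> ix M NumEdges + load a u * ?k" using k unfolding P_def by linarith
      then show "state_ok I a B M' \<and> edges_ok I X (dom a) M' \<and>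
         ix M' NumEdges \<le> ix M NumEdges + load a u * ?k \<and>
         ix M' NumEdges \<le> ix M NumEdges + ?k \<and> t' \<le> t + 9 * ?k + 1"
        using 1 unfolding P_def by simp
    qed
  qed (use ok in auto)
qed

definition graph_ok :: "lbdd \<Rightarrow> (nat \<rightharpoonup> nat) \<Rightarrow> nat set \<Rightarrow> nat set \<Rightarrow> (cell \<rightharpoonup> val) \<Rightarrow> bool" where
  "graph_ok I a B X M \<longleftrightarrow> state_ok I a B M \<and> edges_ok I X (dom a) M \<and>
     ix M NumEdges \<le> num_centers I * (num_centers I + 1)"

text \<open>Common to both graphs: \<open>f u\<close> redirects or drops the top edges leaving
  \<open>u\<close>, and \<open>g u\<close> adds at most one edge, namely the penalty edge of a path
  graph.\<close>

lemma exec_build_graph: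
  assumes ok: "state_ok I a B M" and empty: "ix M NumEdges = 0"
    and f: "\<And>u v v'. v < num_centers I \<Longrightarrow> f u v = Some v' \<Longrightarrow> v' \<le> num_centers I \<and> (v' = num_centers I \<longrightarrow> dom a \<subseteq> X)"
    and g: "\<And>u M' t. u < num_centers I \<Longrightarrow> state_ok I a B M' \<Longrightarrow> edges_ok I X (dom a) M' \<Longrightarrow>
      ix M' NumEdges < num_units I * num_centers I + num_centers I \<Longrightarrow>
      exec (Pow (cells I (load a))) (g u)
       (\<lambda>_ M'' t'. state_ok I a B M'' \<and> edges_ok I X (dom a) M'' \<and> ix M'' NumEdges \<le> Suc (ix M' NumEdges) \<and>
          t' \<le> t + 9) M' t"
  shows "exec (Pow (cells I (load a)))
    (for_each [0..<num_centers I] (\<lambda>u. do { add_top_edges I u (f u); g u }))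
    (\<lambda>_ M' t'. graph_ok I a B X M' \<and> t' \<le> t + num_centers I * (9 * num_centers I + 11)) M t"
proof -
  let ?k = "num_centers I" and ?n = "num_units I" and ?V = "cells I (load a)"
  have dom: "dom a \<subseteq> {..<?n}" using ok unfolding state_ok_def by simp
  \<comment> \<open>The summand \<open>u\<close> and the 1 in \<open>u * (?k + 1)\<close> count the
    edges added by \<open>g\<close>.\<close>
  define P where "P u M' \<longleftrightarrow> state_ok I a B M' \<and> edges_ok I X (dom a) M' \<and>
     ix M' NumEdges \<le> (\<Sum>p<u. load a p) * ?k + u \<and> ix M' NumEdges \<le> u * (?k + 1)" for u M'
  have "exec (Pow ?V) (for_each [0..<?k] (\<lambda>u. do { add_top_edges I u (f u); g u }))
    (\<lambda>_ M' t'. P ?k M' \<and> t' \<le> t + (?k - 0) * ((9 * ?k + 10) + 1)) M t"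
  proof (rule exec_for_each)
    show "P 0 M" using ok empty unfolding P_def edges_ok_def by simp
  next
    fix u M' t assume u: "u < ?k" and P: "P u M'"
    have "(\<Sum>p<Suc u. load a p) * ?k \<le> ?n * ?k" using sum_load_le[OF dom, of "Suc u"] by simp
    then have sum: "(\<Sum>p<u. load a p) * ?k + load a u * ?k \<le> ?n * ?k" by (simp add: algebra_simps)
    show "exec (Pow ?V) (do { add_top_edges I u (f u); g u })
       (\<lambda>_ M' t'. P (Suc u) M' \<and> t' \<le> t + (9 * ?k + 10)) M' t"
    proof (rule exec_bind[OF exec_add_top_edges[where X = X]])
      show "state_ok I a B M'" "edges_ok I X (dom a) M'" using P unfolding P_def by auto
      show "ix M' NumEdges + load a u * ?k \<le> ?n * ?k + ?k" using P sum u unfolding P_def by linarith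
    next
      fix r :: unit and M'' t''
      assume 1: "state_ok I a B M'' \<and> edges_ok I X (dom a) M'' \<and>
        ix M'' NumEdges \<le> ix M' NumEdges + load a u * ?k \<and>
        ix M'' NumEdges \<le> ix M' NumEdges + ?k \<and> t'' \<le> t + 9 * ?k + 1"
      have less: "ix M'' NumEdges < ?n * ?k + ?k" using 1 P sum u unfolding P_def by linarith
      show "exec (Pow ?V) (g u) (\<lambda>_ M' t'. P (Suc u) M' \<and> t' \<le> t + (9 * ?k + 10)) M'' t''"
        by (rule exec_conseq, rule g[where M' = M''])
           (use u less 1 P in \<open>auto simp: P_def algebra_simps\<close>)
    qed (use u f in auto)
  qed simp
  then show ?thesis
    by (rule exec_conseq) (auto simp: P_def graph_ok_def algebra_simps)
qed

lemma exec_build_cycle_graph: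
  assumes ok: "state_ok I a B M" and j: "j < num_centers I"
  shows "exec (Pow (cells I (load a))) (build_cycle_graph I j)
    (\<lambda>_ M' t'. graph_ok I a B (dom a) M' \<and> t' \<le> t + num_centers I * (9 * num_centers I + 11) + 3) M t"
proof -
  let ?M = "M(NumEdges \<mapsto> Idx 0)"
  have "exec (Pow (cells I (load a))) (for_each [0..<num_centers I] (\<lambda>u. do {
       add_top_edges I u (\<lambda>v. Some (if v = j then num_centers I else v)); State_Monad.return () }))
    (\<lambda>_ M' t'. graph_ok I a B (dom a) M' \<and> t' \<le> t + 1 + num_centers I * (9 * num_centers I + 11)) ?M (t + 1)"
    by (rule exec_build_graph)
       (use ok in \<open>auto simp del: bind_right_identity intro!: exec_return state_ok_update split: if_splits\<close>)
  \<comment> \<open>A cycle graph has no penalty edges; the trivial \<open>g\<close> was written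
    only to match the general form and is removed by a monad law.\<close>
  moreover have "(\<lambda>u. State_Monad.bind (add_top_edges I u f) (\<lambda>_. State_Monad.return ())) =
      (\<lambda>u. add_top_edges I u f)" for f
    by (intro ext state_ext) (simp add: split_def)
  ultimately have "exec (Pow (cells I (load a))) (for_each [0..<num_centers I] (\<lambda>u.
       add_top_edges I u (\<lambda>v. Some (if v = j then num_centers I else v))))
    (\<lambda>_ M' t'. graph_ok I a B (dom a) M' \<and> t' \<le> t + num_centers I * (9 * num_centers I + 11) + 3) ?M (t + 1)"
    by (auto elim!: exec_conseq)
  then show ?thesis unfolding build_cycle_graph_def by (intro exec_bind_wr) auto
qed

lemma exec_build_path_graph:
  assumes ok: "state_ok I a B M" and j: "j < num_centers I"
  shows "exec (Pow (cells I (load a))) (build_path_graph I j)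
    (\<lambda>_ M' t'. graph_ok I a B UNIV M' \<and> t' \<le> t + num_centers I * (9 * num_centers I + 11) + 3) M t"
proof -
  let ?V = "cells I (load a)" and ?k = "num_centers I"
  let ?g = "\<lambda>p u. if u = j then State_Monad.return ()
       else do { pu \<leftarrow> next_penalty I u; add_edge u ?k (pu - p) 0 }"
  let ?M = "M(NumEdges \<mapsto> Idx 0)"
  have g: "exec (Pow ?V) (?g p u)
       (\<lambda>_ M'' t'. state_ok I a B M'' \<and> edges_ok I UNIV (dom a) M'' \<and> ix M'' NumEdges \<le> Suc (ix M' NumEdges) \<and>
          t' \<le> t + 9) M' t"
    if M': "u < ?k" "state_ok I a B M'" "edges_ok I UNIV (dom a) M'"
      "ix M' NumEdges < num_units I * ?k + ?k" for p u M' t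
  proof -
    have "exec (Pow ?V) (add_edge u ?k x 0)
       (\<lambda>_ M'' t'. state_ok I a B M'' \<and> edges_ok I UNIV (dom a) M'' \<and> ix M'' NumEdges \<le> Suc (ix M' NumEdges) \<and>
          t' \<le> t + 9) M' s" if s: "s \<le> t + 3" for x s
      by (rule exec_conseq[OF exec_add_edge[where X = UNIV and D = "dom a"]]) (use s M' in auto)
    then show ?thesis
      unfolding next_penalty_def using M' by (intro exec_rules) auto
  qed
  have "exec (Pow ?V) (for_each [0..<?k] (\<lambda>u. do {
       add_top_edges I u (\<lambda>v. if v = j then None else Some v); ?g p u }))
    (\<lambda>_ M' t'. graph_ok I a B UNIV M' \<and> t' \<le> t + 1 + 1 + 1 + ?k * (9 * ?k + 11)) ?M (t + 1 + 1 + 1)" for p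
    by (rule exec_build_graph[OF _ _ _ g])
       (use ok in \<open>auto intro!: state_ok_update split: if_splits\<close>)
  then have "exec (Pow ?V) (for_each [0..<?k] (\<lambda>u. do {
       add_top_edges I u (\<lambda>v. if v = j then None else Some v); ?g p u }))
    (\<lambda>_ M' t'. graph_ok I a B UNIV M' \<and> t' \<le> t + ?k * (9 * ?k + 11) + 3) ?M (t + 1 + 1 + 1)" for p
    by (rule exec_conseq) auto
  then show ?thesis unfolding build_path_graph_def by (intro exec_rules) auto
qed

section \<open>Bellman-Ford\<close>

text \<open>The walk along predecessor edges can be continued from every reached vertex other than
  \<open>j\<close>, each time with a recorded edge. Acyclicity is not asserted; the walk ends
  because \<open>follow_path\<close> counts its rounds.\<close>

definition preds_ok :: "lbdd \<Rightarrow> nat \<Rightarrow> (cell \<rightharpoonup> val) \<Rightarrow> bool" where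
  "preds_ok I j M \<longleftrightarrow> (\<forall>v \<le> num_centers I. ix M (Reached v) \<noteq> 0 \<longrightarrow> v \<noteq> j \<longrightarrow>
     ix M (PredEdge v) < ix M NumEdges \<and> ix M (EdgeDst (ix M (PredEdge v))) = v \<and>
     ix M (Reached (ix M (EdgeSrc (ix M (PredEdge v))))) \<noteq> 0)"

lemma graph_ok_update:
  assumes "graph_ok I a B X M" "c \<in> {Reached v, Dist v, PredEdge v}" "v \<le> num_centers I"
  shows "graph_ok I a B X (M(c \<mapsto> x))"
  using assms unfolding graph_ok_def by (auto intro!: state_ok_update simp: edges_ok_def)

lemma exec_relax:
  assumes "graph_ok I a B X M" "preds_ok I j M" "e < ix M NumEdges"
  shows "exec (Pow (cells I (load a))) (relax e)
    (\<lambda>_ M' t'. (graph_ok I a B X M' \<and> preds_ok I j M' \<and> ix M' NumEdges = ix M NumEdges) \<and> t' \<le> t + 10) M t"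
proof -
  let ?v = "ix M (EdgeDst e)"
  have v: "?v \<le> num_centers I" using assms unfolding graph_ok_def edges_ok_def by simp
  have "graph_ok I a B X (M(Reached ?v \<mapsto> Idx 1, Dist ?v \<mapsto> x, PredEdge ?v \<mapsto> Idx e))" for x
    using assms(1) v by (intro graph_ok_update[where v = ?v]) auto
  moreover have "preds_ok I j (M(Reached ?v \<mapsto> Idx 1, Dist ?v \<mapsto> x, PredEdge ?v \<mapsto> Idx e))"
    if "ix M (Reached (ix M (EdgeSrc e))) \<noteq> 0" for x
    using assms(2,3) that unfolding preds_ok_def by auto
  ultimately show ?thesis
    unfolding relax_def using assms v by (intro exec_rules) (auto simp del: fun_upd_apply simp: fun_upd_other)
qed

text \<open>Three steps to initialize each vertex, two to mark \<open>j\<close> and read the number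
  of edges, then k rounds over at most k (k + 1) edges with 10 steps for a relaxation and one for
  the loop.\<close>

definition bf_time :: "nat \<Rightarrow> nat" where
  "bf_time k = (k + 1) * 3 + 2 + k * (k * (k + 1) * 11 + 1)"

lemma exec_bellman_ford:
  assumes ok: "graph_ok I a B X M" and j: "j < num_centers I"
  shows "exec (Pow (cells I (load a))) (bellman_ford I j)
    (\<lambda>_ M' t'. graph_ok I a B X M' \<and> preds_ok I j M' \<and> t' \<le> t + bf_time (num_centers I)) M t"
proof -
  let ?k = "num_centers I" and ?V = "cells I (load a)"
  define P where "P v M' \<longleftrightarrow> graph_ok I a B X M' \<and> (\<forall>v'<v. ix M' (Reached v') = 0)" for v M'
  have init: "exec (Pow ?V) (for_each [0..<?k + 1] (\<lambda>v. do { wr (Reached v) (Idx 0); wr (Dist v) (Num 0) }))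
    (\<lambda>_ M' t'. P (?k + 1) M' \<and> t' \<le> t + (?k + 1 - 0) * (2 + 1)) M t" for t
  proof (rule exec_for_each)
    fix v M' t assume v: "v < ?k + 1" and P: "P v M'"
    have "graph_ok I a B X (M'(Reached v \<mapsto> Idx 0, Dist v \<mapsto> Num 0))"
      using P v unfolding P_def by (intro graph_ok_update[where v = v]) auto
    then show "exec (Pow ?V) (do { wr (Reached v) (Idx 0); wr (Dist v) (Num 0) })
      (\<lambda>_ M' t'. P (Suc v) M' \<and> t' \<le> t + 2) M' t"
      using P v by (intro exec_rules) (auto simp: P_def less_Suc_eq)
  qed (use ok in \<open>auto simp: P_def\<close>)
  define G where "G m M' \<longleftrightarrow> graph_ok I a B X M' \<and> preds_ok I j M' \<and> ix M' NumEdges = m" for m M'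
  have round: "exec (Pow ?V) (for_each [0..<m] relax)
     (\<lambda>_ M' t'. G m M' \<and> t' \<le> t + (m - 0) * (10 + 1)) M' t" if "G m M'" for m M' t
    by (rule exec_for_each) (use that in \<open>auto simp: G_def intro!: exec_conseq[OF exec_relax]\<close>)
  have rounds: "exec (Pow ?V) (for_each [0..<?k] (\<lambda>_. for_each [0..<m] relax))
     (\<lambda>_ M' t'. G m M' \<and> t' \<le> t + (?k - 0) * (m * 11 + 1)) M' t" if "G m M'" for m M' t
    by (rule exec_for_each) (use that in \<open>auto intro!: exec_conseq[OF round]\<close>)
  show ?thesis unfolding bellman_ford_def
  proof (rule exec_bind[OF init], intro exec_bind_wr exec_bind_rd_idx)
    fix r :: unit and M' t' assume 1: "P (?k + 1) M' \<and> t' \<le> t + (?k + 1 - 0) * (2 + 1)"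
    let ?M = "M'(Reached j \<mapsto> Idx 1)" let ?m = "ix ?M NumEdges"
    have g: "graph_ok I a B X ?M"
      using 1 j unfolding P_def by (intro graph_ok_update[where v = j]) auto
    \<comment> \<open>Vacuous: only the exempt vertex \<open>j\<close> is reached.\<close>
    moreover have "preds_ok I j ?M" using 1 unfolding P_def preds_ok_def by auto
    ultimately have G: "G ?m ?M" unfolding G_def by simp
    have "?m \<le> ?k * (?k + 1)" using g unfolding graph_ok_def by simp
    then have le: "?k * (?m * 11 + 1) \<le> ?k * (?k * (?k + 1) * 11 + 1)" by (intro mult_le_mono2) simp
    show "exec (Pow ?V) (for_each [0..<?k] (\<lambda>_. for_each [0..<?m] relax))
      (\<lambda>_ M' t'. graph_ok I a B X M' \<and> preds_ok I j M' \<and> t' \<le> t + bf_time ?k) ?M (t' + 1 + 1)"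
    proof (intro exec_conseq[OF rounds[OF G]])
      fix r :: unit and M'' t''
      assume 2: "G ?m M'' \<and> t'' \<le> t' + 1 + 1 + (?k - 0) * (?m * 11 + 1)"
      then have "t'' \<le> t' + 1 + 1 + ?k * (?k * (?k + 1) * 11 + 1)"
        using add_left_mono[OF le, of "t' + 1 + 1"] unfolding diff_zero by (blast intro: order_trans)
      then have "t'' \<le> t + bf_time ?k" using 1 unfolding bf_time_def by simp
      then show "graph_ok I a B X M'' \<and> preds_ok I j M'' \<and> t'' \<le> t + bf_time ?k"
        using 2 unfolding G_def by simp
    qed
  qed (use j in auto)
qed

section \<open>Refinement\<close>

text \<open>Exactly the cells read by \<open>edges_ok\<close> and \<open>preds_ok\<close>. They must
  survive the transfers made while the path is being followed.\<close>

fun graph_cell :: "cell \<Rightarrow> bool" where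
  "graph_cell NumEdges = True"
| "graph_cell (EdgeSrc e) = True"
| "graph_cell (EdgeDst e) = True"
| "graph_cell (EdgeUnit e) = True"
| "graph_cell (Reached v) = True"
| "graph_cell (PredEdge v) = True"
| "graph_cell _ = False"

lemma graph_cell_not_allot_cell: "graph_cell c \<Longrightarrow> \<not> allot_cell c"
  by (cases c) auto

text \<open>Bellman-Ford need not be correct here: a transfer takes a unit away from its current center, so
  that the heaps stay consistent whichever predecessor edges are followed. It only matters that the
  edges followed carry allotted units.\<close>

lemma exec_follow_path:
  assumes enter: "\<And>a M t e. state_ok I a B M \<Longrightarrow> dom a = D \<Longrightarrow> edges_ok I X D M \<Longrightarrow>
      e < ix M NumEdges \<Longrightarrow> ix M (EdgeDst e) = num_centers I \<Longrightarrow>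
      exec (footprints I) (enter e) (\<lambda>_ M' t'. (\<exists>a'. dom a' = D \<and> state_ok I a' B M') \<and>
        (\<forall>c. graph_cell c \<longrightarrow> M' c = M c) \<and> t' \<le> t + num_centers I * (41 * b + 30) + 6) M t"
    and b: "num_units I \<le> 2 ^ b"
  shows "state_ok I a B M \<Longrightarrow> dom a = D \<Longrightarrow> edges_ok I X D M \<Longrightarrow> preds_ok I j M \<Longrightarrow>
    v \<le> num_centers I \<Longrightarrow> ix M (Reached v) \<noteq> 0 \<Longrightarrow>
    exec (footprints I) (follow_path I j enter r v)
      (\<lambda>_ M' t'. (\<exists>a'. dom a' = D \<and> state_ok I a' B M') \<and> t' \<le> t + r * (num_centers I * (41 * b + 30) + 9)) M t"
proof (induction r arbitrary: v a M t)
  case 0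
  then show ?case by (auto intro!: exec_return)
next
  case (Suc r)
  let ?k = "num_centers I" and ?e = "ix M (PredEdge v)" let ?u = "ix M (EdgeSrc ?e)"
  let ?T = "?k * (41 * b + 30)"
  let ?step = "if v = ?k then enter ?e else do { d \<leftarrow> rd_idx (EdgeUnit ?e); transfer_unit I d v }"
  have edge: "?e < ix M NumEdges" "ix M (EdgeDst ?e) = v" "ix M (Reached ?u) \<noteq> 0" if "v \<noteq> j"
    using Suc.prems that unfolding preds_ok_def by auto
  then have u: "?u \<le> ?k" if "v \<noteq> j" using Suc.prems that unfolding edges_ok_def by (metis less_imp_le)
  \<comment> \<open>The 6 is the cost of entering the in-copy of a path graph: a read,
    \<open>take_slot\<close> with 3 steps, and a read and a write of \<open>Over j\<close>. The tick
    and the two reads before it make 9 for each edge.\<close>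
  have step: "exec (footprints I) ?step (\<lambda>_ M' t'. (\<exists>a'. dom a' = D \<and> state_ok I a' B M') \<and>
        (\<forall>c. graph_cell c \<longrightarrow> M' c = M c) \<and> t' \<le> t + ?T + 6) M t" if vj: "v \<noteq> j" for t
  proof (intro exec_if exec_bind_rd_idx)
    assume "v = ?k"
    then show "exec (footprints I) (enter ?e) (\<lambda>_ M' t'. (\<exists>a'. dom a' = D \<and> state_ok I a' B M') \<and>
        (\<forall>c. graph_cell c \<longrightarrow> M' c = M c) \<and> t' \<le> t + ?T + 6) M t"
      using Suc.prems edge[OF vj] by (intro enter) auto
  next
    assume "v \<noteq> ?k"
    then have "ix M (EdgeUnit ?e) \<in> dom a" "v < ?k"
      using edge[OF vj] Suc.prems unfolding edges_ok_def by auto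
    then show "exec (footprints I) (transfer_unit I (ix M (EdgeUnit ?e)) v)
        (\<lambda>_ M' t'. (\<exists>a'. dom a' = D \<and> state_ok I a' B M') \<and>
        (\<forall>c. graph_cell c \<longrightarrow> M' c = M c) \<and> t' \<le> t + ?T + 6) M (t + 1)"
      using Suc.prems graph_cell_not_allot_cell
      by (intro exec_conseq[OF exec_transfer_unit[OF Suc.prems(1) _ _ b]]) auto
  qed
  have rest: "exec (footprints I) (follow_path I j enter r ?u)
      (\<lambda>_ M' t'. (\<exists>a'. dom a' = D \<and> state_ok I a' B M') \<and> t' \<le> t + Suc r * (?T + 9)) M' t'"
    if vj: "v \<noteq> j" and 1: "(\<exists>a'. dom a' = D \<and> state_ok I a' B M') \<and>
        (\<forall>c. graph_cell c \<longrightarrow> M' c = M c) \<and> t' \<le> t + 3 + ?T + 6" for M' t'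
  proof -
    obtain a' where a': "dom a' = D" "state_ok I a' B M'" using 1 by auto
    have "edges_ok I X D M'" "preds_ok I j M'" "ix M' (Reached ?u) \<noteq> 0"
      using Suc.prems 1 edge[OF vj] unfolding edges_ok_def preds_ok_def by simp_all
    from Suc.IH[OF a'(2,1) this(1,2) u[OF vj] this(3)] show ?thesis
      by (rule exec_conseq) (use 1 in auto)
  qed
  show ?case
  proof (cases "v = j")
    case True
    then show ?thesis using Suc.prems by (auto intro!: exec_return)
  next
    case False
    show ?thesis unfolding follow_path.simps if_not_P[OF False]
      by (intro exec_bind_tick exec_bind_rd_idx, rule exec_bind[OF step[OF False]], rule rest[OF False])
         (simp add: numeral_3_eq_3)
  qed
qed

lemma exec_add_to_objective:
  assumes "state_ok I a B M"
  shows "exec (footprints I) (add_to_objective x) (\<lambda>_ M' t'. state_ok I a B M' \<and> t' \<le> t + 2) M t"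
  unfolding add_to_objective_def
  by (rule exec_lift[OF _ assms]) (use assms in \<open>auto intro!: exec_rules state_ok_update\<close>)

lemma exec_take_slot:
  assumes "state_ok I a B M" "u < num_centers I"
  shows "exec (footprints I) (take_slot u)
    (\<lambda>_ M' t'. state_ok I a B M' \<and> (\<forall>c. graph_cell c \<longrightarrow> M' c = M c) \<and> t' \<le> t + 3) M t"
  unfolding take_slot_def
  by (rule exec_lift[OF _ assms(1)], intro exec_rules) (use assms in \<open>auto intro!: state_ok_update\<close>)

text \<open>Includes building the graph, which is why \<open>exec_refine\<close> measures from an
  earlier time \<open>t0\<close>. The 7 consists of 3 steps around that construction, two reads and
  the update of the objective.\<close>

definition refine_time :: "nat \<Rightarrow> nat \<Rightarrow> nat" where
  "refine_time k b = k * (9 * k + 11) + bf_time k + k * (k * (41 * b + 30) + 9) + 7"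

lemma exec_refine:
  assumes ok: "graph_ok I a B X M" and j: "j < num_centers I" and b: "num_units I \<le> 2 ^ b"
    and enter: "\<And>a' M t e. state_ok I a' B M \<Longrightarrow> dom a' = dom a \<Longrightarrow> edges_ok I X (dom a) M \<Longrightarrow>
      e < ix M NumEdges \<Longrightarrow> ix M (EdgeDst e) = num_centers I \<Longrightarrow>
      exec (footprints I) (enter e) (\<lambda>_ M' t'. (\<exists>a'. dom a' = dom a \<and> state_ok I a' B M') \<and>
        (\<forall>c. graph_cell c \<longrightarrow> M' c = M c) \<and> t' \<le> t + num_centers I * (41 * b + 30) + 6) M t"
    and t: "t \<le> t0 + num_centers I * (9 * num_centers I + 11) + 3"
  shows "exec (footprints I) (refine I j enter)
    (\<lambda>_ M' t'. (\<exists>a'. dom a' = dom a \<and> state_ok I a' B M') \<and> t' \<le> t0 + refine_time (num_centers I) b) M t"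
proof -
  have sok: "state_ok I a B M" using ok unfolding graph_ok_def by simp
  show ?thesis unfolding refine_def
  proof (rule exec_bind[OF exec_lift[OF exec_bellman_ford[OF ok j] sok]],
      intro exec_bind_rd_idx exec_bind_rd_num exec_if)
    let ?k = "num_centers I"
    fix r :: unit and M' t'
    assume 1: "graph_ok I a B X M' \<and> preds_ok I j M' \<and> t' \<le> t + bf_time ?k"
    then have 2: "state_ok I a B M'" "edges_ok I X (dom a) M'" "preds_ok I j M'"
      unfolding graph_ok_def by auto
    {
      assume "ix M' (Reached ?k) \<noteq> 0 \<and> num (the (M' (Dist ?k))) < 0"
      then have reached: "ix M' (Reached ?k) \<noteq> 0" by simp
      have "exec (footprints I) (follow_path I j enter ?k ?k) (\<lambda>_ M'' t''.
          (\<exists>a'. dom a' = dom a \<and> state_ok I a' B M'') \<and>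
          t'' \<le> t' + 1 + 1 + ?k * (?k * (41 * b + 30) + 9)) M' (t' + 1 + 1)"
        by (rule exec_follow_path[OF _ b 2(1) refl 2(2,3) order_refl reached], rule enter) assumption+
      then show "exec (footprints I) (do { follow_path I j enter ?k ?k; add_to_objective (num (the (M' (Dist ?k)))) })
        (\<lambda>_ M' t'. (\<exists>a'. dom a' = dom a \<and> state_ok I a' B M') \<and> t' \<le> t0 + refine_time ?k b) M' (t' + 1 + 1)"
        by (rule exec_bind)
           (use 1 t in \<open>auto intro!: exec_conseq[OF exec_add_to_objective] simp: refine_time_def\<close>)
    next
      assume "\<not> (ix M' (Reached ?k) \<noteq> 0 \<and> num (the (M' (Dist ?k))) < 0)"
      show "exec (footprints I) (State_Monad.return ())
        (\<lambda>_ M' t'. (\<exists>a'. dom a' = dom a \<and> state_ok I a' B M') \<and> t' \<le> t0 + refine_time ?k b) M' (t' + 1 + 1)"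
        by (rule exec_return) (use 1 2 t in \<open>auto simp: refine_time_def\<close>)
    }
  qed
qed

lemma exec_negative_cycle_refinement:
  assumes ok: "state_ok I a B M" and j: "j < num_centers I" and b: "num_units I \<le> 2 ^ b"
  shows "exec (footprints I) (negative_cycle_refinement I j)
    (\<lambda>_ M' t'. (\<exists>a'. dom a' = dom a \<and> state_ok I a' B M') \<and> t' \<le> t + refine_time (num_centers I) b) M t"
  unfolding negative_cycle_refinement_def
proof (rule exec_bind[OF exec_lift[OF exec_build_cycle_graph[OF ok j] ok]])
  fix r :: unit and M' t'
  assume 1: "graph_ok I a B (dom a) M' \<and> t' \<le> t + num_centers I * (9 * num_centers I + 11) + 3"
  show "exec (footprints I) (refine I j (\<lambda>e. do { d \<leftarrow> rd_idx (EdgeUnit e); transfer_unit I d j }))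
    (\<lambda>_ M' t'. (\<exists>a'. dom a' = dom a \<and> state_ok I a' B M') \<and> t' \<le> t + refine_time (num_centers I) b) M' t'"
  proof (rule exec_refine[where X = "dom a"])
    fix a' M t e
    assume 2: "state_ok I a' B M" "dom a' = dom a" "edges_ok I (dom a) (dom a) M" "e < ix M NumEdges"
    then have "ix M (EdgeUnit e) \<in> dom a'" unfolding edges_ok_def by auto
    then show "exec (footprints I) (do { d \<leftarrow> rd_idx (EdgeUnit e); transfer_unit I d j })
      (\<lambda>_ M' t'. (\<exists>a'. dom a' = dom a \<and> state_ok I a' B M') \<and>
        (\<forall>c. graph_cell c \<longrightarrow> M' c = M c) \<and> t' \<le> t + num_centers I * (41 * b + 30) + 6) M t"
      using 2 j graph_cell_not_allot_cell
      by (intro exec_bind_rd_idx exec_conseq[OF exec_transfer_unit[OF 2(1) _ _ b]]) auto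
  qed (use 1 j b in auto)
qed

lemma exec_negative_path_refinement:
  assumes ok: "state_ok I a B M" and j: "j < num_centers I" and b: "num_units I \<le> 2 ^ b"
  shows "exec (footprints I) (negative_path_refinement I j)
    (\<lambda>_ M' t'. (\<exists>a'. dom a' = dom a \<and> state_ok I a' B M') \<and> t' \<le> t + refine_time (num_centers I) b) M t"
  unfolding negative_path_refinement_def
proof (rule exec_bind[OF exec_lift[OF exec_build_path_graph[OF ok j] ok]])
  let ?enter = "\<lambda>e. do {
       u \<leftarrow> rd_idx (EdgeSrc e);
       take_slot u;
       ov \<leftarrow> rd_idx (Over j);
       wr (Over j) (Idx (ov - 1)) }"
  fix r :: unit and M' t'
  assume 1: "graph_ok I a B UNIV M' \<and> t' \<le> t + num_centers I * (9 * num_centers I + 11) + 3"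
  show "exec (footprints I) (refine I j ?enter)
    (\<lambda>_ M' t'. (\<exists>a'. dom a' = dom a \<and> state_ok I a' B M') \<and> t' \<le> t + refine_time (num_centers I) b) M' t'"
  proof (rule exec_refine[where X = UNIV])
    fix a' M t e
    assume 2: "state_ok I a' B M" "dom a' = dom a" "edges_ok I UNIV (dom a) M" "e < ix M NumEdges"
    then have u: "ix M (EdgeSrc e) < num_centers I" unfolding edges_ok_def by auto
    show "exec (footprints I) (?enter e)
      (\<lambda>_ M' t'. (\<exists>a'. dom a' = dom a \<and> state_ok I a' B M') \<and>
        (\<forall>c. graph_cell c \<longrightarrow> M' c = M c) \<and> t' \<le> t + num_centers I * (41 * b + 30) + 6) M t"
    proof (rule exec_bind_rd_idx, rule exec_bind[OF exec_take_slot[OF 2(1) u]])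
      fix r :: unit and M' t'
      assume 3: "state_ok I a' B M' \<and> (\<forall>c. graph_cell c \<longrightarrow> M' c = M c) \<and> t' \<le> t + 1 + 3"
      then have 4: "state_ok I a' B (M'(Over j \<mapsto> x))" for x using j by (intro state_ok_update) auto
      show "exec (footprints I) (do { ov \<leftarrow> rd_idx (Over j); wr (Over j) (Idx (ov - 1)) })
        (\<lambda>_ M' t'. (\<exists>a'. dom a' = dom a \<and> state_ok I a' B M') \<and>
        (\<forall>c. graph_cell c \<longrightarrow> M' c = M c) \<and> t' \<le> t + num_centers I * (41 * b + 30) + 6) M' t'"
        using 2 3 4 j
        by (intro exec_lift[of I a' _ _ _ _ B] exec_rules conjI exI[of _ a']) auto
    qed
  qed (use 1 j b in auto)
qed

section \<open>The main loop\<close>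

text \<open>The 13 collects 4 steps of \<open>add_unit\<close>, reading the cost and the capacity, 3
  for \<open>take_slot\<close>, the penalty with its index, and 2 for the objective.\<close>

definition process_time :: "nat \<Rightarrow> nat \<Rightarrow> nat" where
  "process_time k b = k * (13 * b + 6) + 2 * refine_time k b + 13"

lemma exec_process_unit:
  assumes ok: "state_ok I a B M" and d: "a d = None" "d < num_units I" "d \<notin> B"
    and j: "j < num_centers I" and b: "num_units I \<le> 2 ^ b"
  shows "exec (footprints I) (process_unit I d j)
    (\<lambda>_ M' t'. (\<exists>a'. dom a' = insert d (dom a) \<and> state_ok I a' B M') \<and>
      t' \<le> t + process_time (num_centers I) b) M t"
  unfolding process_unit_def
proof (rule exec_bind[OF exec_add_unit'[OF assms]], rule exec_bind, rule exec_negative_cycle_refinement[OF _ j b],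
    erule conjunct1, elim conjE exE, intro exec_bind_rd_num exec_bind_rd_idx, rule exec_bind, rule exec_take_slot[OF _ j],
    assumption, elim conjE exE, intro exec_if exec_bind_rd_idx exec_bind_eval_penalty, goal_cases)
  case (1 r M1 t1 r2 M2 t2 a' r3 M3 t3)
  then show ?case
    by (intro exec_conseq[OF exec_add_to_objective[of I a' B]]) (auto simp: process_time_def)
next
  case (2 r M1 t1 r2 M2 t2 a' r3 M3 t3)
  show ?case
  proof (rule exec_bind[OF exec_add_to_objective])
    show "state_ok I a' B M3" using 2 by blast
  next
    fix r :: unit and M4 t4
    assume 4: "state_ok I a' B M4 \<and> t4 \<le> t3 + 1 + 1 + 2"
    then have 5: "state_ok I a' B M4" by simp
    show "exec (footprints I) (negative_path_refinement I j)
      (\<lambda>_ M' t'. (\<exists>a'. dom a' = insert d (dom a) \<and> state_ok I a' B M') \<and>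
      t' \<le> t + process_time (num_centers I) b) M4 t4"
      by (rule exec_conseq[OF exec_negative_path_refinement[OF 5 j b]])
         (use 2 4 in \<open>auto simp: process_time_def\<close>)
  qed
qed

text \<open>\<open>Smin d\<close> is read after the deletion, when \<open>d\<close> is no longer
  pending and \<open>state_ok\<close> is silent about it; therefore its preservation is stated
  separately.\<close>

lemma exec_pop:
  assumes ok: "state_ok I a B M" and d: "d \<in> B" and b: "num_units I \<le> 2 ^ b"
  shows "exec (footprints I) (heap_delete Pending (card B) d)
    (\<lambda>_ M' t'. state_ok I a (B - {d}) M' \<and> ix M' (Smin d) = ix M (Smin d) \<and> t' \<le> t + 28 * b + 16) M t"
proof -
  have B: "B \<subseteq> {..<num_units I}" "heaps I (contents a B) M" using ok unfolding state_ok_def by auto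
  have hok: "heap_ok M Pending B" using state_ok_heap_ok[OF ok, of Pending] by simp
  have fin: "finite B" using B(1) finite_subset by blast
  have card: "card B \<le> num_units I" using card_mono[OF _ B(1)] by simp
  have room: "heap_room (cells I (load a)) Pending B"
    using B card unfolding heap_room_def by auto
  have "exec (Pow (cells I (load a))) (heap_delete Pending (card B) d)
    (\<lambda>_ M' t'. state_ok I a (B - {d}) M' \<and> ix M' (Smin d) = ix M (Smin d) \<and> t' \<le> t + 28 * b + 16) M t"
  proof (rule exec_conseq[OF exec_heap_delete[OF hok fin d _ room]])
    show "card B \<le> 2 ^ b" using card b by simp
  next
    fix r :: unit and M' t'
    assume 1: "heap_ok M' Pending (B - {d}) \<and> (\<forall>c. c \<notin> heap_cells Pending B \<longrightarrow> M' c = M c) \<and>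
      t' \<le> t + 28 * b + 16" and dom: "dom M' \<in> Pow (cells I (load a))"
    have "heaps I ((contents a B)(Pending := B - {d})) M'"
    proof (rule heaps_update[OF B(2)])
      show "M' c = M c" if "c \<notin> heap_cells Pending (B - {d} \<union> contents a B Pending)" for c
        using 1 that by (simp add: Un_absorb1)
      show "pos_cell Pending e \<noteq> pos_cell h' e" if "h' \<noteq> Pending" for h' e
        using that by (cases h') auto
    qed (use 1 B in auto)
    moreover have "(contents a B)(Pending := B - {d}) = contents a (B - {d})"
    proof
      show "((contents a B)(Pending := B - {d})) h = contents a (B - {d}) h" for h by (cases h) auto
    qed
    moreover have "M' c = M c" if "\<not> heap_cell c" for c
      using 1 that heap_cells_heap_cell by blast
    ultimately show "state_ok I a (B - {d}) M' \<and> ix M' (Smin d) = ix M (Smin d) \<and> t' \<le> t + 28 * b + 16"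
      using 1 dom ok unfolding state_ok_def by auto
  qed
  then show ?thesis using exec_lift[OF _ ok] by blast
qed

lemma exec_push:
  assumes ok: "state_ok I a B M" and d: "d \<notin> B" "a d = None" "d < num_units I" "ix M (Smin d) < num_centers I"
    and b: "num_units I \<le> 2 ^ b"
  shows "exec (Pow (cells I (load a))) (heap_insert Pending (card B) d x)
    (\<lambda>_ M' t'. state_ok I a (insert d B) M' \<and> t' \<le> t + 13 * b + 4) M t"
proof -
  have B: "B \<subseteq> {..<num_units I}" "heaps I (contents a B) M" using ok unfolding state_ok_def by auto
  have hok: "heap_ok M Pending B" using state_ok_heap_ok[OF ok, of Pending] by simp
  have fin: "finite B" using B(1) finite_subset by blast
  have "insert d B \<subseteq> {..<num_units I}" using B d by auto
  from card_mono[OF _ this] have card: "Suc (card B) \<le> num_units I" using fin d by simp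
  have room: "heap_room (cells I (load a)) Pending (insert d B)"
    using B card d fin unfolding heap_room_def by auto
  show ?thesis
  proof (rule exec_conseq[OF exec_heap_insert[OF hok fin d(1) _ room]])
    show "card B < 2 ^ b" using card b by simp
  next
    fix r :: unit and M' t'
    assume 1: "heap_ok M' Pending (insert d B) \<and> (\<forall>c. c \<notin> heap_cells Pending (insert d B) \<longrightarrow> M' c = M c) \<and>
      t' \<le> t + 13 * b + 4" and dom: "dom M' \<in> Pow (cells I (load a))"
    have "heaps I ((contents a B)(Pending := insert d B)) M'"
    proof (rule heaps_update[OF B(2)])
      show "M' c = M c" if "c \<notin> heap_cells Pending (insert d B \<union> contents a B Pending)" for c
        using 1 that by simp
      show "pos_cell Pending e \<noteq> pos_cell h' e" if "h' \<noteq> Pending" for h' e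
        using that by (cases h') auto
    qed (use 1 B d in auto)
    moreover have "(contents a B)(Pending := insert d B) = contents a (insert d B)"
    proof
      show "((contents a B)(Pending := insert d B)) h = contents a (insert d B) h" for h by (cases h) auto
    qed
    moreover have "M' c = M c" if "\<not> heap_cell c" for c
      using 1 that heap_cells_heap_cell by blast
    ultimately show "state_ok I a (insert d B) M' \<and> t' \<le> t + 13 * b + 4"
      using 1 dom ok d unfolding state_ok_def by auto
  qed
qed

lemma exec_asral_loop:
  assumes b: "num_units I \<le> 2 ^ b"
  shows "state_ok I a B M \<Longrightarrow> card B = m \<Longrightarrow> exec (footprints I) (asral_loop I m)
    (\<lambda>_ M' t'. t' \<le> t + m * (process_time (num_centers I) b + 28 * b + 19)) M t"
proof (induction m arbitrary: a B M t)
  case 0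
  then show ?case by (auto intro!: exec_return)
next
  case (Suc m)
  let ?d = "ix M (Item Pending 0)"
  have "heap_ok M Pending B" using state_ok_heap_ok[OF Suc.prems(1), of Pending] by simp
  then have d: "?d \<in> B" using Suc.prems(2) unfolding heap_ok_def by auto
  then have d': "a ?d = None" "?d < num_units I" "ix M (Smin ?d) < num_centers I"
    using Suc.prems unfolding state_ok_def by auto
  show ?case unfolding asral_loop.simps unfolding Suc.prems(2)[symmetric]
  proof (intro exec_bind_tick exec_bind_rd_idx, rule exec_bind[OF exec_pop[OF Suc.prems(1) d b]],
      rule exec_bind_rd_idx)
    fix r :: unit and M1 t1
    assume 1: "state_ok I a (B - {?d}) M1 \<and> ix M1 (Smin ?d) = ix M (Smin ?d) \<and> t1 \<le> t + 1 + 1 + 28 * b + 16"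
    show "exec (footprints I) (do { process_unit I ?d (ix M1 (Smin ?d)); asral_loop I m })
      (\<lambda>_ M' t'. t' \<le> t + card B * (process_time (num_centers I) b + 28 * b + 19)) M1 (t1 + 1)"
    proof (rule exec_bind[OF exec_process_unit[OF _ _ _ _ _ b]])
      fix r :: unit and M2 t2
      assume 2: "(\<exists>a'. dom a' = insert ?d (dom a) \<and> state_ok I a' (B - {?d}) M2) \<and>
        t2 \<le> t1 + 1 + process_time (num_centers I) b"
      then obtain a' where a': "state_ok I a' (B - {?d}) M2" by blast
      have "card (B - {?d}) = m" using d Suc.prems by simp
      from Suc.IH[OF a' this] show "exec (footprints I) (asral_loop I m)
        (\<lambda>_ M' t'. t' \<le> t + card B * (process_time (num_centers I) b + 28 * b + 19)) M2 t2"
        by (rule exec_conseq) (use 1 2 Suc.prems in auto)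
    qed (use 1 d d' in auto)
  qed
qed

section \<open>Initialization\<close>

lemma exec_find_smin:
  assumes ok: "state_ok I a B M" and d: "d \<notin> B" "d < num_units I" and k: "1 \<le> num_centers I"
  shows "exec (Pow (cells I (load a))) (find_smin I d)
    (\<lambda>_ M' t'. state_ok I a B M' \<and> ix M' (Smin d) < num_centers I \<and> t' \<le> t + 5 * num_centers I) M t"
proof -
  let ?k = "num_centers I" and ?V = "cells I (load a)"
  define P where "P M' \<longleftrightarrow> state_ok I a B M' \<and> ix M' (Smin d) < ?k" for M'
  \<comment> \<open>\<open>state_ok\<close> constrains \<open>Smin\<close> only on \<open>B\<close>,
    and \<open>d\<close> is not yet pending.\<close>
  have upd: "P (M'(Smin d \<mapsto> Idx s))" if "state_ok I a B M'" "s < ?k" for M' s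
  proof -
    have "heaps I (contents a B) (M'(Smin d \<mapsto> Idx s))"
      by (rule heaps_cong[of I "contents a B" M']) (use that in \<open>auto simp: state_ok_def\<close>)
    then show ?thesis using that d unfolding P_def state_ok_def by auto
  qed
  have loop: "exec (Pow ?V) (for_each [1..<?k] (\<lambda>s. do {
       x \<leftarrow> rd_num (Cost d s);
       b \<leftarrow> rd_idx (Smin d);
       y \<leftarrow> rd_num (Cost d b);
       if x < y then wr (Smin d) (Idx s) else State_Monad.return () }))
     (\<lambda>_ M' t'. P M' \<and> t' \<le> t + (?k - 1) * (4 + 1)) M' t" if "P M'" for M' t
  proof (rule exec_for_each)
    fix s M' t assume "s < ?k" "P M'"
    then show "exec (Pow ?V) (do {
       x \<leftarrow> rd_num (Cost d s);
       b \<leftarrow> rd_idx (Smin d);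
       y \<leftarrow> rd_num (Cost d b);
       if x < y then wr (Smin d) (Idx s) else State_Monad.return () })
      (\<lambda>_ M' t'. P M' \<and> t' \<le> t + 4) M' t"
      using d upd by (intro exec_rules) (auto simp: P_def simp del: fun_upd_apply)
  qed (use that k in auto)
  show ?thesis unfolding find_smin_def
    by (rule exec_bind_wr, use d in simp, rule exec_conseq[OF loop])
       (use upd[OF ok] k in \<open>auto simp: P_def\<close>)
qed

definition init_time :: "nat \<Rightarrow> nat \<Rightarrow> nat \<Rightarrow> nat" where
  "init_time n k b = 1 + k * 3 + n * (5 * k + 13 * b + 7)"

lemma exec_asral_init:
  assumes k: "1 \<le> num_centers I" and b: "num_units I \<le> 2 ^ b"
  shows "exec (Pow (cells I (load Map.empty))) (asral_init I)
    (\<lambda>_ M' t'. state_ok I Map.empty {..<num_units I} M' \<and>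
       t' \<le> t + init_time (num_units I) (num_centers I) b) (input_memory I) t"
proof -
  let ?k = "num_centers I" and ?n = "num_units I" and ?V = "cells I (load Map.empty)"
  define P where "P s M \<longleftrightarrow> (\<forall>c. heap_cell c \<longrightarrow> M c = None) \<and> (\<forall>p<s. ix M (Load p) = 0)" for s M
  have loop: "exec (Pow ?V) (for_each [0..<?k] (\<lambda>s. do { wr (Load s) (Idx 0); wr (Over s) (Idx 0) }))
    (\<lambda>_ M' t'. P ?k M' \<and> t' \<le> t + (?k - 0) * (2 + 1)) M t" if "P 0 M" for M t
  proof (rule exec_for_each)
    fix s M t assume "s < ?k" "P s M"
    then show "exec (Pow ?V) (do { wr (Load s) (Idx 0); wr (Over s) (Idx 0) })
      (\<lambda>_ M' t'. P (Suc s) M' \<and> t' \<le> t + 2) M t"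
      by (intro exec_rules) (auto simp: P_def less_Suc_eq)
  qed (use that in auto)
  have units: "exec (Pow ?V) (for_each [0..<?n] (\<lambda>d. do {
       find_smin I d;
       b \<leftarrow> rd_idx (Smin d);
       x \<leftarrow> rd_num (Cost d b);
       heap_insert Pending d d x }))
     (\<lambda>_ M' t'. state_ok I Map.empty {..<?n} M' \<and> t' \<le> t + (?n - 0) * ((5 * ?k + 13 * b + 6) + 1)) M t"
    if "state_ok I Map.empty {} M" for M t
  proof (rule exec_for_each[where P = "\<lambda>d. state_ok I Map.empty {..<d}"])
    fix d M t assume d: "d < ?n" and ok: "state_ok I Map.empty {..<d} M"
    show "exec (Pow ?V) (do {
       find_smin I d;
       b \<leftarrow> rd_idx (Smin d);
       x \<leftarrow> rd_num (Cost d b);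
       heap_insert Pending d d x })
      (\<lambda>_ M' t'. state_ok I Map.empty {..<Suc d} M' \<and> t' \<le> t + (5 * ?k + 13 * b + 6)) M t"
    proof (rule exec_bind[OF exec_find_smin[OF ok _ d k]], simp, intro exec_bind_rd_idx exec_bind_rd_num)
      fix r :: unit and M' t' and x
      assume 1: "state_ok I Map.empty {..<d} M' \<and> ix M' (Smin d) < ?k \<and> t' \<le> t + 5 * ?k"
      \<comment> \<open>Units are inserted in increasing order, so that \<open>d\<close> is at once
        the new unit and the current size of the heap.\<close>
      have "exec (Pow ?V) (heap_insert Pending (card {..<d}) d x)
        (\<lambda>_ M'' t''. state_ok I Map.empty (insert d {..<d}) M'' \<and> t'' \<le> t' + 1 + 1 + 13 * b + 4) M' (t' + 1 + 1)" for x
        by (rule exec_push) (use 1 d b in auto)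
      then have "exec (Pow ?V) (heap_insert Pending d d x)
        (\<lambda>_ M'' t''. state_ok I Map.empty {..<Suc d} M'' \<and> t'' \<le> t' + 1 + 1 + 13 * b + 4) M' (t' + 1 + 1)" for x
        by (simp add: lessThan_Suc)
      then show "exec (Pow ?V) (heap_insert Pending d d (num (the (M' (Cost d (ix M' (Smin d)))))))
        (\<lambda>_ M' t'. state_ok I Map.empty {..<Suc d} M' \<and> t' \<le> t + (5 * ?k + 13 * b + 6)) M' (t' + 1 + 1)"
        by (rule exec_conseq) (use 1 in auto)
    qed
  qed (use that in auto)
  have "input_memory I c = None" if "heap_cell c" for c using that by (cases c) auto
  then have P0: "P 0 ((input_memory I)(Objective \<mapsto> v))" for v unfolding P_def by auto
  show ?thesis unfolding asral_init_def
  proof (rule exec_bind_wr, simp, rule exec_bind[OF loop[OF P0]])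
    fix r :: unit and M t'
    assume 1: "P ?k M \<and> t' \<le> t + 1 + (?k - 0) * (2 + 1)" and dom: "dom M \<in> Pow ?V"
    have empty: "contents Map.empty {} h = {}" for h by (cases h) auto
    have "heap_ok M h {}" for h using 1 unfolding P_def heap_ok_def by simp
    then have "heaps I (contents Map.empty {}) M" unfolding heaps_def empty by simp
    then have "state_ok I Map.empty {} M"
      using 1 dom unfolding state_ok_def P_def by (simp add: load_def)
    from units[OF this] show "exec (Pow ?V) (for_each [0..<?n] (\<lambda>d. do {
       find_smin I d;
       b \<leftarrow> rd_idx (Smin d);
       x \<leftarrow> rd_num (Cost d b);
       heap_insert Pending d d x }))
     (\<lambda>_ M' t'. state_ok I Map.empty {..<?n} M' \<and> t' \<le> t + init_time ?n ?k b) M t'"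
      by (rule exec_conseq) (use 1 in \<open>auto simp: init_time_def algebra_simps\<close>)
  qed
qed

section \<open>The whole run and the arithmetic of the bounds\<close>

definition total_time :: "nat \<Rightarrow> nat \<Rightarrow> nat \<Rightarrow> nat" where
  "total_time n k b = init_time n k b + n * (process_time k b + 28 * b + 19)"

lemma asral_bounds:
  assumes I: "lbdd_instance I" and b: "num_units I \<le> 2 ^ b"
  shows "asral_time I \<le> total_time (num_units I) (num_centers I) b"
    and "asral_space I \<le> 30 * (num_units I * num_centers I)"
proof -
  have nk: "1 \<le> num_units I" "1 \<le> num_centers I" using I unfolding lbdd_instance_def by auto
  let ?V = "cells I (load Map.empty)"
  have small: "card X \<le> 30 * (num_units I * num_centers I)" if X: "X \<in> footprints I" for X
  proof -
    obtain a where a: "dom a \<subseteq> {..<num_units I}" "X \<subseteq> cells I (load a)"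
      using X unfolding footprints_def by blast
    note cells = card_cells[OF sum_load_le[OF a(1)] nk]
    show ?thesis
      by (rule order_trans[OF card_mono[OF cells(1) a(2)] cells(2)])
  qed
  have input: "dom (input_memory I) \<subseteq> ?V"
  proof
    show "c \<in> ?V" if "c \<in> dom (input_memory I)" for c using that by (cases c) (auto split: if_splits)
  qed
  then have input': "dom (input_memory I) \<in> footprints I" unfolding footprints_def
    by (intro CollectI exI[of _ Map.empty]) simp
  have "exec (footprints I) (asral_init I)
    (\<lambda>_ M' t'. state_ok I Map.empty {..<num_units I} M' \<and>
       t' \<le> 0 + init_time (num_units I) (num_centers I) b) (input_memory I) 0"
    by (rule exec_conseq[OF exec_footprints[OF exec_asral_init[OF nk(2) b]]]) (use input in auto)
  then have "exec (footprints I) (asral I)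
    (\<lambda>_ M' t'. t' \<le> total_time (num_units I) (num_centers I) b) (input_memory I) 0"
    unfolding asral_def
  proof (rule exec_bind)
    fix r :: unit and M' t'
    assume 1: "state_ok I Map.empty {..<num_units I} M' \<and> t' \<le> 0 + init_time (num_units I) (num_centers I) b"
    then have 2: "state_ok I Map.empty {..<num_units I} M'" by simp
    show "exec (footprints I) (asral_loop I (num_units I))
      (\<lambda>_ M' t'. t' \<le> total_time (num_units I) (num_centers I) b) M' t'"
      by (rule exec_conseq[OF exec_asral_loop[OF b 2]]) (use 1 in \<open>auto simp: total_time_def\<close>)
  qed
  then have exec: "exec (footprints I) (asral I)
    (\<lambda>_ M' t'. t' \<le> total_time (num_units I) (num_centers I) b) (input_memory I) 0" .
  have run: "case run_state (asral I) s of (r, s') \<Rightarrow>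
      steps s' \<le> total_time (num_units I) (num_centers I) b \<and> dom (memory s') \<in> footprints I \<and>
      (\<forall>S. (\<forall>X\<in>footprints I. card X \<le> S) \<longrightarrow> peak s' \<le> max (peak s) S)"
    if "memory s = input_memory I" "steps s = 0" for s
  proof -
    from exec[unfolded exec_def, rule_format, OF input' that] show ?thesis .
  qed
  define s0 where "s0 = \<lparr>memory = input_memory I, steps = 0, peak = card (dom (input_memory I))\<rparr>"
  obtain r s where r: "run_state (asral I) s0 = (r, s)" by (rule prod.exhaust)
  have final: "steps s \<le> total_time (num_units I) (num_centers I) b"
    "\<And>S. (\<forall>X\<in>footprints I. card X \<le> S) \<Longrightarrow> peak s \<le> max (card (dom (input_memory I))) S"
    using run[of s0] unfolding r prod.case by (simp_all only: s0_def machine.simps)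
  \<comment> \<open>The initial peak is the size of the input, whose domain is itself a footprint;
    with S = 30 n k both arguments of the maximum are bounded.\<close>
  have "asral_run I = s" unfolding asral_run_def s0_def[symmetric] r by simp
  then show "asral_time I \<le> total_time (num_units I) (num_centers I) b"
    "asral_space I \<le> 30 * (num_units I * num_centers I)"
    unfolding asral_time_def asral_space_def
    using final(1) order_trans[OF final(2)] small small[OF input'] by (simp_all only: max.bounded_iff) blast
qed

lemma total_time_le:
  fixes n k b :: nat
  assumes "1 \<le> n" "1 \<le> k"
  shows "total_time n k b \<le> 1000 * (n * k ^ 3 + n * k ^ 2 * b)"
proof -
  \<comment> \<open>Every monomial of the running time of one iteration is at most \<open>K\<close>:
    those with \<open>b\<close> are compared with k^2 b, the others with k^3, because
    \<open>b\<close> is 0 for n = 1.\<close>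
  define K where "K = k ^ 3 + k ^ 2 * b"
  have k: "k ^ 2 = k * k" "k ^ 3 = k * k * k" by (simp_all add: power2_eq_square power3_eq_cube)
  have "1 \<le> k * k * k" "k \<le> k * k * k" "k * k \<le> k * k * k" "b \<le> k * k * b" "k * b \<le> k * k * b"
    using assms(2) by auto
  then have le: "1 \<le> K" "k \<le> K" "k * k \<le> K" "b \<le> K" "k * b \<le> K" "k * k * k + k * k * b = K"
    unfolding K_def k by linarith+
  have "process_time k b = 22 * (k * k * k) + 100 * (k * k) + 54 * k + 37 + 82 * (k * k * b) + 13 * (k * b)"
    unfolding process_time_def refine_time_def bf_time_def by (simp add: algebra_simps)
  then have "process_time k b + 28 * b + 19 \<le> 500 * K" using le by linarith
  then have "n * (process_time k b + 28 * b + 19) \<le> n * (500 * K)" by (rule mult_le_mono2)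
  moreover have "5 * k + 13 * b + 7 \<le> 25 * K" using le by linarith
  then have "n * (5 * k + 13 * b + 7) \<le> n * (25 * K)" by (rule mult_le_mono2)
  moreover have "K \<le> n * K" using assms(1) by simp
  moreover have "1 + k * 3 \<le> 4 * K" using le by linarith
  ultimately have "total_time n k b \<le> 1000 * (n * K)"
    unfolding total_time_def init_time_def by linarith
  then show ?thesis unfolding K_def by (simp add: algebra_simps)
qed

theorem theorem4p3:
  shows "\<exists>C::real. \<forall>I. lbdd_instance I \<longrightarrow>
    (let n = real (num_units I); k = real (num_centers I) in
       real (asral_time I) \<le> C * (n * k ^ 3 + n * k ^ 2 * log 2 n) \<and>
       real (asral_space I) \<le> C * (n * k))"
proof (intro exI allI impI)
  fix I assume I: "lbdd_instance I"
  define n k where "n = num_units I" and "k = num_centers I"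
  have nk: "1 \<le> n" "1 \<le> k" using I unfolding lbdd_instance_def n_def k_def by auto
  \<comment> \<open>The least exponent with n <= 2^b. Rounding costs a summand n k^2, which is
    absorbed by n k^3 and not by the logarithmic term, as the latter vanishes for n = 1.\<close>
  define b where "b = nat \<lceil>log 2 n\<rceil>"
  have log: "0 \<le> log 2 n" using nk by simp
  then have b: "log 2 n \<le> b" "b \<le> log 2 n + 1" unfolding b_def by linarith+
  have "real n = 2 powr (log 2 n)" using nk by simp
  also have "\<dots> \<le> 2 powr b" using b by simp
  finally have "real n \<le> real (2 ^ b)" by (simp add: powr_realpow)
  then have "num_units I \<le> 2 ^ b" unfolding n_def of_nat_le_iff .
  note bounds = asral_bounds[OF I this, folded n_def k_def]
  have "real (asral_time I) \<le> real (1000 * (n * k ^ 3 + n * k ^ 2 * b))"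
    using bounds(1) total_time_le[OF nk, of b] by linarith
  then have "real (asral_time I) \<le> 1000 * (real n * real k ^ 3) + 1000 * (real n * real k ^ 2 * b)"
    by (simp add: algebra_simps)
  moreover have "real n * real k ^ 2 * b \<le> real n * real k ^ 2 * (log 2 n + 1)"
    using b by (intro mult_left_mono) auto
  then have "real n * real k ^ 2 * b \<le> real n * real k ^ 2 * log 2 n + real n * real k ^ 2"
    by (simp add: algebra_simps)
  moreover have "real n * real k ^ 2 \<le> real n * real k ^ 3"
    using nk by (intro mult_left_mono power_increasing) auto
  moreover have "0 \<le> real n * real k ^ 2 * log 2 n" using log by simp
  \<comment> \<open>The absorbed summand is what doubles the constant 1000.\<close>
  moreover have "T \<le> 2000 * (X + Y)" if "T \<le> 1000 * X + 1000 * Z" "Z \<le> Y + W" "W \<le> X" "0 \<le> Y"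
    for T W X Y Z :: real using that by argo
  ultimately have "real (asral_time I) \<le> 2000 * (real n * real k ^ 3 + real n * real k ^ 2 * log 2 n)"
    by blast
  moreover have "real (asral_space I) \<le> real (30 * (n * k))" using bounds(2) by linarith
  then have "real (asral_space I) \<le> 2000 * (real n * real k)" by simp
  ultimately show "let n = real (num_units I); k = real (num_centers I) in
       real (asral_time I) \<le> 2000 * (n * k ^ 3 + n * k ^ 2 * log 2 n) \<and>
       real (asral_space I) \<le> 2000 * (n * k)"
    unfolding Let_def n_def k_def by simp
qed

end
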